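(* There exist infinitely many positive integers $n$ for which there is a $\Theta_6$-free planar graph $G$ on $n$ vertices whose number of edges is $$e(G)=\frac{18}{7}n-\frac{48}{7}.$$
   Context: All graphs are planar, undirected, finite, and have neither loops nor multiple edges. For $k\geq 4$, $\Theta_k$ denotes the family of Theta graphs on $k$ vertices, i.e. graphs obtained from a cycle on $k$ vertices by joining a pair of non-consecutive vertices of the cycle with an edge. A graph is $\Theta_k$-free if it contains no member of $\Theta_k$ as a (not necessarily induced) subgraph; equivalently, no $k$-cycle in it has a chord. *)

theory Defs
  imports "HOL-Analysis.Analysis"
begin

definition simple_graph :: "'a set \<Rightarrow> 'a set set \<Rightarrow> bool" where
  "simple_graph V E \<longleftrightarrow> finite V \<and> (\<forall>e\<in>E. e \<subseteq> V \<and> card e = 2)"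

definition subgraph :: "'a set \<Rightarrow> 'a set set \<Rightarrow> 'a set \<Rightarrow> 'a set set \<Rightarrow> bool" where
  "subgraph V' E' V E \<longleftrightarrow> simple_graph V' E' \<and> V' \<subseteq> V \<and> E' \<subseteq> E"

text \<open>
  Planarity is topological: vertices go to distinct points \<open>p v\<close> and every edge \<open>e\<close> to an arc
  \<open>g e\<close> joining the images of its two ends, such that the interior of an edge (the arc without
  its two end points) contains no vertex and no point of any other edge.
\<close>

definition plane_drawing ::
    "'a set \<Rightarrow> 'a set set \<Rightarrow> ('a \<Rightarrow> real \<times> real) \<Rightarrow> ('a set \<Rightarrow> real \<Rightarrow> real \<times> real) \<Rightarrow> bool" where
  "plane_drawing V E p g \<longleftrightarrow>
     inj_on p V \<and>
     (\<forall>e\<in>E. arc (g e) \<and> {pathstart (g e), pathfinish (g e)} = p ` e) \<and>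
     (\<forall>e\<in>E. (path_image (g e) - p ` e) \<inter> p ` V = {}) \<and>
     (\<forall>e\<in>E. \<forall>f\<in>E. e \<noteq> f \<longrightarrow> (path_image (g e) - p ` e) \<inter> path_image (g f) = {})"

definition planar :: "'a set \<Rightarrow> 'a set set \<Rightarrow> bool" where
  "planar V E \<longleftrightarrow> (\<exists>p g. plane_drawing V E p g)"

text \<open>The edges of the cycle through the vertices of the list \<open>vs\<close> in order, closing up at the
  end. This is a cycle only if \<open>vs\<close> is distinct of length at least 3.\<close>

definition cycle_edges :: "'a list \<Rightarrow> 'a set set" where
  "cycle_edges vs = {{vs ! i, vs ! (Suc i mod length vs)} | i. i < length vs}"

text \<open>Membership in the family \<open>\<Theta>\<^sub>k\<close>, meant for \<open>k \<ge> 4\<close>; for smaller \<open>k\<close> the family is empty.\<close>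

definition theta_graph :: "nat \<Rightarrow> 'a set \<Rightarrow> 'a set set \<Rightarrow> bool" where
  "theta_graph k V E \<longleftrightarrow>
     k \<ge> 4 \<and>
     (\<exists>vs x y. distinct vs \<and> length vs = k \<and> V = set vs \<and>
        x \<in> set vs \<and> y \<in> set vs \<and> x \<noteq> y \<and> {x, y} \<notin> cycle_edges vs \<and>
        E = insert {x, y} (cycle_edges vs))"

definition theta_free :: "nat \<Rightarrow> 'a set \<Rightarrow> 'a set set \<Rightarrow> bool" where
  "theta_free k V E \<longleftrightarrow> \<not> (\<exists>V' E'. theta_graph k V' E' \<and> subgraph V' E' V E)"

end

theory Submission
  imports Defs
begin

text \<open>
  The complete graph on five vertices minus one edge, drawn in a triangle so that three of its
  vertices lie on the outer face, has nine edges. If each of the three outer vertices is shared with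
  one further copy, then a copy accounts for \<open>2 + 3/2 = 7/2\<close> vertices, which gives the ratio
  \<open>9 / (7/2) = 18/7\<close>. Such copies are put into the cells of a triangular lattice, with the outer
  vertices at the midpoints of the sides of the cell. The faces between the copies then surround the
  lattice vertices and are hexagons. A sphere cannot be tiled by hexagons that meet three at a
  time, and the curvature has to be concentrated where it costs no edges. This is done by gluing two copies (front
  and back) of a triangle of side \<open>3 m\<close> along their boundaries: the lattice is flat everywhere
  except at the three corners. At a corner the front cell and the back cell have two sides in common,
  and together they carry one block with five vertices and eight edges. Counting cells gives
  \<open>63 m\<^sup>2 - 9\<close> vertices and \<open>162 m\<^sup>2 - 30\<close> edges, which meets the required equation for every \<open>m\<close>.

  \<^emph>\<open>No theta graph.\<close> Cells that share a side can be coloured alternately black and white. A vertex at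
  the midpoint of a side joins a black cell to a white one, so the vertices behave like the edges of a
  bipartite graph on the cells, and adjacent vertices have a black or a white cell in common. This
  bipartite graph has no 4-cycle, and its only multiple edges are the pairs of common sides at the three
  corners. Following the colours along a cycle of length at most five, the number of changes of
  colour is even, and four changes would produce a 4-cycle of cells; hence the
  cycle stays inside one cluster, that is, a single cell or the union of the two cells at a corner, and
  a cluster has at most five vertices. A theta graph on six vertices is the union of two cycles of
  length at most five which share the chord. Clusters with two common vertices lie in a common cluster
  (\<open>cluster_join\<close>), which would have to contain six vertices. The argument is carried out abstractly in the
  locale \<open>bipartite_labelling\<close>; \<open>labelling\<close> shows that the graph satisfies its axioms.

  \<^emph>\<open>Planarity.\<close> The front triangle is placed around the origin and its edges are straight segments. The
  back triangle uses the same segments, followed by the radial map that exchanges the inside and the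
  outside of the triangle and fixes its boundary (\<open>flip\<close>). It is undefined only at the origin,
  which is a lattice vertex in the interior and lies on no edge. Disjointness of edges reduces to two facts:
  an interior point of a cell lies on no segment of another cell, on the same sheet or on the other one
  (\<open>chart_separate_sheets\<close>), and the nine segments in one cell do not cross (\<open>link_cross\<close>).
\<close>

section \<open>Theta graphs on six vertices and bipartite labellings\<close>

text \<open>
  Up to a rotation of the six-cycle, a chord joins its first vertex to the third or to the fourth.
\<close>

lemma theta6_freeI:
  assumes "\<And>a b c d e f. distinct [a, b, c, d, e, f] \<Longrightarrow>
      {{a,b},{b,c},{c,d},{d,e},{e,f},{f,a}} \<subseteq> E \<Longrightarrow> {a,c} \<notin> E \<and> {a,d} \<notin> E"
  shows "theta_free 6 V E"
  unfolding theta_free_def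
proof (rule notI, elim exE conjE)
  fix V' E' assume "theta_graph 6 V' E'" and sub: "subgraph V' E' V E"
  then obtain vs x y where vs: "distinct vs" "length vs = 6" "x \<in> set vs" "y \<in> set vs" "x \<noteq> y"
      "{x, y} \<notin> cycle_edges vs" and E': "E' = insert {x, y} (cycle_edges vs)"
    unfolding theta_graph_def by blast
  obtain a b c d e f where l: "vs = [a, b, c, d, e, f]"
    using vs(2) by (auto simp: eval_nat_numeral length_Suc_conv)
  have six: "{..<6::nat} = {0, 1, 2, 3, 4, 5}" by auto
  have "cycle_edges vs = (\<lambda>i. {vs ! i, vs ! (Suc i mod length vs)}) ` {..<6}"
    unfolding cycle_edges_def vs(2) by auto
  also have "\<dots> = {{a,b},{b,c},{c,d},{d,e},{e,f},{f,a}}"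
    unfolding six by (simp add: l)
  finally have ce: "cycle_edges vs = {{a,b},{b,c},{c,d},{d,e},{e,f},{f,a}}" .
  have EE: "{x, y} \<in> E" "{{a,b},{b,c},{c,d},{d,e},{e,f},{f,a}} \<subseteq> E"
    using sub E' ce by (auto simp: subgraph_def)
  have dist: "distinct [a, b, c, d, e, f]" using vs(1) l by simp
  have 1: "{a,c} \<notin> E \<and> {a,d} \<notin> E"
    by (rule assms[OF dist]) (use EE in auto)
  have 2: "{b,d} \<notin> E \<and> {b,e} \<notin> E"
    by (rule assms[of b c d e f a]) (use EE dist in auto)
  have 3: "{c,e} \<notin> E \<and> {c,f} \<notin> E"
    by (rule assms[of c d e f a b]) (use EE dist in auto)
  have 4: "{d,f} \<notin> E" 
    using assms[of d e f a b c] EE dist by auto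
  have 5: "{e,a} \<notin> E"
    using assms[of e f a b c d] EE dist by auto
  have 6: "{f,b} \<notin> E"
    using assms[of f a b c d e] EE dist by auto
  have chord: "{a,c} \<notin> E" "{c,a} \<notin> E" "{a,d} \<notin> E" "{d,a} \<notin> E" "{b,d} \<notin> E" "{d,b} \<notin> E"
      "{b,e} \<notin> E" "{e,b} \<notin> E" "{c,e} \<notin> E" "{e,c} \<notin> E" "{c,f} \<notin> E" "{f,c} \<notin> E"
      "{d,f} \<notin> E" "{f,d} \<notin> E" "{a,e} \<notin> E" "{e,a} \<notin> E" "{b,f} \<notin> E" "{f,b} \<notin> E"
    using 1 2 3 4 5 6 by (simp_all only: insert_commute not_False_eq_True)
  have "x = a \<or> x = b \<or> x = c \<or> x = d \<or> x = e \<or> x = f"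
    "y = a \<or> y = b \<or> y = c \<or> y = d \<or> y = e \<or> y = f"
    using vs(3,4) l by simp_all
  moreover have "{x, y} \<notin> {{a,b},{b,c},{c,d},{d,e},{e,f},{f,a}}" using vs(6) ce by simp
  ultimately show False
    using EE(1) vs(5) by (elim disjE) (simp_all add: chord doubleton_eq_iff)
qed

text \<open>
  The labels \<open>B v\<close> and \<open>W v\<close> are the two ends of \<open>v\<close> when the vertices are read as the edges of a
  bipartite multigraph. Assumption \<open>no_4_cycle\<close> excludes 4-cycles in that multigraph, and \<open>twins\<close> says that
  an edge with a parallel edge has only one, and that no two such pairs have an end in common.
\<close>

locale bipartite_labelling =
  fixes V :: "'a set" and E :: "'a set set" and B :: "'a \<Rightarrow> 'b" and W :: "'a \<Rightarrow> 'c"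
  assumes finV: "finite V" and EV: "\<And>e. e \<in> E \<Longrightarrow> e \<subseteq> V"
    and share: "\<And>u v. {u, v} \<in> E \<Longrightarrow> B u = B v \<or> W u = W v"
    and no_4_cycle: "\<And>t u v w. t \<in> V \<Longrightarrow> u \<in> V \<Longrightarrow> v \<in> V \<Longrightarrow> w \<in> V \<Longrightarrow>
        B t = B u \<Longrightarrow> W u = W v \<Longrightarrow> B v = B w \<Longrightarrow> W w = W t \<Longrightarrow> B u = B v \<or> W v = W w"
    and twins: "\<And>t u v w. t \<in> V \<Longrightarrow> u \<in> V \<Longrightarrow> v \<in> V \<Longrightarrow> w \<in> V \<Longrightarrow>
        t \<noteq> u \<Longrightarrow> B t = B u \<Longrightarrow> W t = W u \<Longrightarrow> v \<noteq> w \<Longrightarrow> B v = B w \<Longrightarrow> W v = W w \<Longrightarrow>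
        B t = B v \<or> W t = W v \<Longrightarrow> {t, u} = {v, w}"
    and card_black: "\<And>x. card {v \<in> V. B v = x} \<le> 5"
    and card_white: "\<And>x. card {v \<in> V. W v = x} \<le> 5"
    and card_twins: "\<And>u v. u \<in> V \<Longrightarrow> v \<in> V \<Longrightarrow> u \<noteq> v \<Longrightarrow> B u = B v \<Longrightarrow> W u = W v \<Longrightarrow>
        card {w \<in> V. B w = B u \<or> W w = W u} \<le> 5"
begin

text \<open>
  The candidates for a vertex set which contains a given short cycle. The third kind is needed for
  cycles that change colour exactly twice, at the two members of a pair of twins.
\<close>

inductive cluster :: "'a set \<Rightarrow> bool" where
  black_fibre: "cluster {v \<in> V. B v = x}"
| white_fibre: "cluster {v \<in> V. W v = x}"
| twin_pair: "u \<in> V \<Longrightarrow> v \<in> V \<Longrightarrow> u \<noteq> v \<Longrightarrow> B u = B v \<Longrightarrow> W u = W v \<Longrightarrow>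
    cluster {w \<in> V. B w = B u \<or> W w = W u}"

lemma cluster_card:
  assumes "cluster S"
  shows "card S \<le> 5"
  using assms
proof cases
  case (twin_pair u v)
  show ?thesis unfolding twin_pair(1) by (rule card_twins[OF twin_pair(2-6)])
qed (simp_all only: card_black card_white)

lemma cluster_sub:
  assumes "cluster S"
  shows "S \<subseteq> V"
  using assms by cases (simp_all only: Collect_subset Collect_restrict)

text \<open>
  If \<open>x\<close> and \<open>y\<close> in the cluster of the twins \<open>u\<close>, \<open>v\<close> had a common black label other than that of
  \<open>u\<close>, they would share the white label of \<open>u\<close>, and so form a second pair of twins there.
\<close>

lemma twins_black_fibre:
  assumes tw: "u \<in> V" "v \<in> V" "u \<noteq> v" "B u = B v" "W u = W v"
    and xy: "x \<in> V" "y \<in> V" "x \<noteq> y" "B x = b" "B y = b"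
    and near: "B x = B u \<or> W x = W u" "B y = B u \<or> W y = W u"
  shows "B u = b"
proof (rule ccontr)
  assume ne: "B u \<noteq> b"
  then have wx: "W x = W u" "W y = W u" using xy(4,5) near by auto
  have "{x, y} = {u, v}"
    by (rule twins[OF xy(1,2) tw(1,2) xy(3) _ _ tw(3-5)]) (simp_all add: xy(4,5) wx)
  then have "u = x \<or> u = y" by blast
  then show False using ne xy(4,5) by blast
qed

lemma twins_white_fibre:
  assumes tw: "u \<in> V" "v \<in> V" "u \<noteq> v" "B u = B v" "W u = W v"
    and xy: "x \<in> V" "y \<in> V" "x \<noteq> y" "W x = b" "W y = b"
    and near: "B x = B u \<or> W x = W u" "B y = B u \<or> W y = W u"
  shows "W u = b"
proof (rule ccontr)
  assume ne: "W u \<noteq> b"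
  then have wx: "B x = B u" "B y = B u" using xy(4,5) near by auto
  have "{x, y} = {u, v}"
    by (rule twins[OF xy(1,2) tw(1,2) xy(3) _ _ tw(3-5)]) (simp_all add: xy(4,5) wx)
  then have "u = x \<or> u = y" by blast
  then show False using ne xy(4,5) by blast
qed

text \<open>
  Two vertices common to the clusters of two pairs of twins with different labels could only be the two
  crosswise combinations of those labels, and these would close a 4-cycle with the twins.
\<close>

lemma twin_unique:
  assumes tw: "u \<in> V" "v \<in> V" "u \<noteq> v" "B u = B v" "W u = W v"
    and tw': "u' \<in> V" "v' \<in> V" "u' \<noteq> v'" "B u' = B v'" "W u' = W v'"
    and xy: "x \<in> V" "y \<in> V" "x \<noteq> y"
    and near: "B x = B u \<or> W x = W u" "B y = B u \<or> W y = W u"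
    and near': "B x = B u' \<or> W x = W u'" "B y = B u' \<or> W y = W u'"
  shows "B u = B u' \<and> W u = W u'"
proof (cases "B u = B u' \<or> W u = W u'")
  case True
  have "{u, v} = {u', v'}"
    by (rule twins[OF tw(1,2) tw'(1,2) tw(3-5) tw'(3-5) True])
  then have "u = u' \<or> u = v'" by blast
  then show ?thesis using tw'(4,5) by (elim disjE) simp_all
next
  case False
  have x: "B x = B u \<and> W x = W u' \<or> B x = B u' \<and> W x = W u" using near(1) near'(1) False by metis
  have y: "B y = B u \<and> W y = W u' \<or> B y = B u' \<and> W y = W u" using near(2) near'(2) False by metis
  have ne: "\<not> (B x = B y \<and> W x = W y)"
  proof
    assume "B x = B y \<and> W x = W y"
    then have xyt: "B x = B y" "W x = W y" by auto
    have "B u = B y" by (rule twins_black_fibre[OF tw xy xyt(1) refl near])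
    moreover have "B u' = B y" by (rule twins_black_fibre[OF tw' xy xyt(1) refl near'])
    ultimately show False using False by simp
  qed
  have "B u = B u' \<or> W u = W u'"
  proof (cases "B x = B u \<and> W x = W u'")
    case True
    then have "B y = B u'" "W y = W u" using y ne by metis+
    then show ?thesis using True no_4_cycle[of u x u' y] tw(1) xy tw'(1) by metis
  next
    case no: False
    then have xx: "B x = B u'" "W x = W u" using x by blast+
    then have "B y = B u" "W y = W u'" using y ne by metis+
    then show ?thesis using xx no_4_cycle[of u y u' x] tw(1) xy tw'(1) by metis
  qed
  then show ?thesis using False by blast
qed

text \<open>
  Two clusters meeting in two vertices need not be comparable: a black and a white fibre can meet in a
  pair of twins, and then the twins span a cluster containing both.
\<close>

lemma cluster_join:
  assumes "cluster S" "cluster S'" "x \<in> S" "y \<in> S" "x \<in> S'" "y \<in> S'" "x \<noteq> y"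
  shows "\<exists>T. cluster T \<and> S \<union> S' \<subseteq> T"
proof -
  have sub: ?thesis if "S \<subseteq> S'" using assms(2) that by (metis Un_absorb1 order_refl)
  have sub': ?thesis if "S' \<subseteq> S" using assms(1) that by (metis Un_absorb2 order_refl)
  have xy: "x \<in> V" "y \<in> V" using assms cluster_sub by blast+
  show ?thesis
    using assms(1)
  proof cases
    case S: (black_fibre b)
    have bx: "B x = b" "B y = b" using assms(3,4) unfolding S by simp_all
    show ?thesis using assms(2)
    proof cases
      case S': (black_fibre b')
      have "b' = b" using assms(5) bx unfolding S' by simp
      then show ?thesis using sub S S' by simp
    next
      case S': (white_fibre w)
      have wx: "W x = w" "W y = w" using assms(5,6) unfolding S' by simp_all
      have "S \<union> S' \<subseteq> {z \<in> V. B z = B x \<or> W z = W x}" unfolding S S' bx wx by blast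
      moreover have "cluster {z \<in> V. B z = B x \<or> W z = W x}"
        by (rule twin_pair[OF xy assms(7)]) (simp_all add: bx wx)
      ultimately show ?thesis by blast
    next
      case S': (twin_pair u v)
      have bu: "b = B u"
        by (rule sym, rule twins_black_fibre[OF S'(2-6) xy assms(7) bx]) (use assms(5,6) in \<open>simp_all add: S'(1)\<close>)
      show ?thesis by (rule sub) (unfold S S'(1) bu, blast)
    qed
  next
    case S: (white_fibre b)
    have bx: "W x = b" "W y = b" using assms(3,4) unfolding S by simp_all
    show ?thesis using assms(2)
    proof cases
      case S': (white_fibre b')
      have "b' = b" using assms(5) bx unfolding S' by simp
      then show ?thesis using sub S S' by simp
    next
      case S': (black_fibre w)
      have wx: "B x = w" "B y = w" using assms(5,6) unfolding S' by simp_all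
      have "S \<union> S' \<subseteq> {z \<in> V. B z = B x \<or> W z = W x}" unfolding S S' bx wx by blast
      moreover have "cluster {z \<in> V. B z = B x \<or> W z = W x}"
        by (rule twin_pair[OF xy assms(7)]) (simp_all add: bx wx)
      ultimately show ?thesis by blast
    next
      case S': (twin_pair u v)
      have bu: "b = W u"
        by (rule sym, rule twins_white_fibre[OF S'(2-6) xy assms(7) bx]) (use assms(5,6) in \<open>simp_all add: S'(1)\<close>)
      show ?thesis by (rule sub) (unfold S S'(1) bu, blast)
    qed
  next
    case S: (twin_pair u v)
    have near: "B x = B u \<or> W x = W u" "B y = B u \<or> W y = W u"
      using assms(3,4) unfolding S(1) by simp_all
    show ?thesis using assms(2)
    proof cases
      case S': (black_fibre b)
      have bx: "B x = b" "B y = b" using assms(5,6) unfolding S' by simp_all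
      have bu: "b = B u" by (rule sym, rule twins_black_fibre[OF S(2-6) xy assms(7) bx near])
      show ?thesis by (rule sub') (unfold S(1) S' bu, blast)
    next
      case S': (white_fibre b)
      have bx: "W x = b" "W y = b" using assms(5,6) unfolding S' by simp_all
      have bu: "b = W u" by (rule sym, rule twins_white_fibre[OF S(2-6) xy assms(7) bx near])
      show ?thesis by (rule sub') (unfold S(1) S' bu, blast)
    next
      case S': (twin_pair u' v')
      have near': "B x = B u' \<or> W x = W u'" "B y = B u' \<or> W y = W u'"
        using assms(5,6) unfolding S'(1) by simp_all
      have "B u = B u'" "W u = W u'"
        using twin_unique[OF S(2-6) S'(2-6) xy assms(7) near near'] by blast+
      then show ?thesis by (intro sub) (simp add: S(1) S'(1))
    qed
  qed
qed

text \<open>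
  Four changes of colour give a closed walk of length four on the labels; it must degenerate, and then
  it passes twice through parallel edges, giving two pairs of twins with a common label.
\<close>

lemma no_alternating_4:
  assumes V: "t \<in> V" "u \<in> V" "v \<in> V" "w \<in> V" and d: "distinct [t, u, v, w]"
    and tu: "B t = B u" and uv: "W u = W v" and vw: "B v = B w" and wt: "W w = W t"
  shows False
proof -
  have "B u = B v \<or> W v = W w" by (rule no_4_cycle[OF V tu uv vw wt])
  then show False
  proof
    assume b: "B u = B v"
    have "{u, v} = {w, t}"
      by (rule twins[OF V(2,3,4,1) _ b uv _ _ wt]) (use d b vw tu in auto)
    then show False using d by auto
  next
    assume w: "W v = W w"
    have "{t, u} = {v, w}"
      by (rule twins[OF V(1,2,3,4) _ tu _ _ vw w]) (use d w uv wt in auto)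
    then show False using d by auto
  qed
qed

definition shares :: "'a \<Rightarrow> 'a \<Rightarrow> bool" where
  "shares u v \<longleftrightarrow> B u = B v \<or> W u = W v"

text \<open>
  A middle vertex \<open>v\<close> of an aligned triple can be skipped in a cycle, because \<open>u\<close> and \<open>w\<close> share a label as
  well. This is what shortens cycles in the following lemmas.
\<close>

definition aligned :: "'a \<Rightarrow> 'a \<Rightarrow> 'a \<Rightarrow> bool" where
  "aligned u v w \<longleftrightarrow> B u = B v \<and> B v = B w \<or> W u = W v \<and> W v = W w"

lemma aligned_shares: "aligned u v w \<Longrightarrow> shares u w"
  unfolding aligned_def shares_def by argo

text \<open>
  The skipped vertex comes back by joining the cluster with the fibre of the common label.
\<close>

lemma cluster_insert:
  assumes S: "cluster S" "u \<in> S" "w \<in> S" "u \<noteq> w" and v: "v \<in> V" "aligned u v w"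
  shows "\<exists>T. cluster T \<and> insert v S \<subseteq> T"
proof -
  have V: "u \<in> V" "w \<in> V" using S cluster_sub by blast+
  from v(2) have "\<exists>S'. cluster S' \<and> u \<in> S' \<and> v \<in> S' \<and> w \<in> S'"
    unfolding aligned_def
  proof (elim disjE conjE)
    assume "B u = B v" "B v = B w"
    then show ?thesis using black_fibre[of "B v"] V v(1) by (intro exI[of _ "{z \<in> V. B z = B v}"]) simp
  next
    assume "W u = W v" "W v = W w"
    then show ?thesis using white_fibre[of "W v"] V v(1) by (intro exI[of _ "{z \<in> V. W z = W v}"]) simp
  qed
  then obtain S' where S': "cluster S'" "u \<in> S'" "v \<in> S'" "w \<in> S'" by blast
  show ?thesis using cluster_join[OF S(1) S'(1) S(2,3) S'(2,4) S(4)] S'(3) by blast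
qed

lemma cluster_cycle3:
  assumes d: "distinct [a, b, c]" and V: "{a,b,c} \<subseteq> V" and s: "shares a b" "shares b c" "shares c a"
  shows "\<exists>S. cluster S \<and> {a,b,c} \<subseteq> S"
proof -
  have two: "p = r \<and> q = r \<or> p' = r' \<and> q' = r'"
    if "p = q \<or> p' = q'" "q = r \<or> q' = r'" "r = p \<or> r' = p'" for p q r :: 'b and p' q' r' :: 'c
    using that by auto
  have "B a = B c \<and> B b = B c \<or> W a = W c \<and> W b = W c"
    using s unfolding shares_def by (rule two)
  then show ?thesis
  proof
    assume "B a = B c \<and> B b = B c"
    then have "{a,b,c} \<subseteq> {z \<in> V. B z = B c}" using V by simp
    then show ?thesis using black_fibre by blast
  next
    assume "W a = W c \<and> W b = W c"
    then have "{a,b,c} \<subseteq> {z \<in> V. W z = W c}" using V by simp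
    then show ?thesis using white_fibre by blast
  qed
qed

text \<open>
  Unless the colours alternate all the way around, some vertex can be skipped.
\<close>

lemma cluster_cycle4:
  assumes d: "distinct [a, b, c, d]" and V: "{a,b,c,d} \<subseteq> V"
    and s: "shares a b" "shares b c" "shares c d" "shares d a"
  shows "\<exists>S. cluster S \<and> {a,b,c,d} \<subseteq> S"
proof -
  have *: "\<exists>S. cluster S \<and> {p,q,r,t} \<subseteq> S"
    if h: "distinct [p, q, r, t]" "{p,q,r,t} \<subseteq> V" "shares r t" "shares t p" "aligned p q r" for p q r t
  proof -
    obtain S where S: "cluster S" "{p,r,t} \<subseteq> S"
      using cluster_cycle3[of p r t] aligned_shares[of p q r] h by auto
    show ?thesis using cluster_insert[of S p r q] h S by auto
  qed
  have alt4: "\<not> (B p = B q \<and> W q = W r \<and> B r = B t \<and> W t = W p)"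
    if "p \<in> V" "q \<in> V" "r \<in> V" "t \<in> V" "distinct [p, q, r, t]" for p q r t
    using no_alternating_4[OF that] by blast
  have alt: "\<not> (B a = B b \<and> W b = W c \<and> B c = B d \<and> W d = W a)"
      "\<not> (B b = B c \<and> W c = W d \<and> B d = B a \<and> W a = W b)"
    using alt4[of a b c d] alt4[of b c d a] d V by (simp_all add: eq_commute)
  have "aligned a b c \<or> aligned b c d \<or> aligned c d a \<or> aligned d a b"
    using s alt unfolding shares_def aligned_def by argo
  then show ?thesis
    using *[of a b c d] *[of b c d a] *[of c d a b] *[of d a b c] d V s
    by (elim disjE) (auto simp: insert_commute)
qed

text \<open>
  The length is odd, so two consecutive edges can be given the same colour and their common vertex can be
  skipped.
\<close>

lemma cluster_cycle5:
  assumes d: "distinct [a, b, c, d, e]" and V: "{a,b,c,d,e} \<subseteq> V"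
    and s: "shares a b" "shares b c" "shares c d" "shares d e" "shares e a"
  shows "\<exists>S. cluster S \<and> {a,b,c,d,e} \<subseteq> S"
proof -
  have *: "\<exists>S. cluster S \<and> {p,q,r,t,u} \<subseteq> S"
    if h: "distinct [p, q, r, t, u]" "{p,q,r,t,u} \<subseteq> V" "shares r t" "shares t u" "shares u p" "aligned p q r"
    for p q r t u
  proof -
    obtain S where S: "cluster S" "{p,r,t,u} \<subseteq> S"
      using cluster_cycle4[of p r t u] aligned_shares[of p q r] h by auto
    show ?thesis using cluster_insert[of S p r q] h S by auto
  qed
  have "aligned a b c \<or> aligned b c d \<or> aligned c d e \<or> aligned d e a \<or> aligned e a b"
    using s unfolding shares_def aligned_def by argo
  then show ?thesis
    using *[of a b c d e] *[of b c d e a] *[of c d e a b] *[of d e a b c] *[of e a b c d] d V s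
    by (elim disjE) (auto simp: insert_commute)
qed

text \<open>
  A chord splits the six-cycle into cycles of length three and five, or two of length four. Their
  clusters share both ends of the chord, so one cluster contains all six vertices.
\<close>

lemma no_chord:
  assumes D: "distinct [a, b, c, d, e, f]" and E: "{{a,b},{b,c},{c,d},{d,e},{e,f},{f,a}} \<subseteq> E"
  shows "{a,c} \<notin> E \<and> {a,d} \<notin> E"
proof -
  have V: "{a,b,c,d,e,f} \<subseteq> V" using E EV by auto
  have sh: "shares u v" if "{u, v} \<in> E" for u v using share that unfolding shares_def .
  have s: "shares a b" "shares b c" "shares c d" "shares d e" "shares e f" "shares f a"
    using E sh by auto
  have no: False if h: "cluster S" "cluster S'" "{a,b,c,d,e,f} \<subseteq> S \<union> S'" 
    "x \<in> S \<inter> S'" "y \<in> S \<inter> S'" "x \<noteq> y" for S S' x y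
  proof -
    obtain T where T: "cluster T" "S \<union> S' \<subseteq> T" using cluster_join[of S S' x y] h by blast
    have "card {a,b,c,d,e,f} \<le> card T"
      using T h(3) cluster_sub[OF T(1)] finV by (meson card_mono finite_subset subset_trans)
    then show False using cluster_card[OF T(1)] D by simp
  qed
  show "{a,c} \<notin> E \<and> {a,d} \<notin> E"
  proof (intro conjI notI)
    assume "{a,c} \<in> E"
    then have ac: "shares a c" "shares c a" using sh[of a c] sh[of c a] by (auto simp: insert_commute)
    obtain S where S: "cluster S" "{a,b,c} \<subseteq> S"
      using cluster_cycle3[of a b c] D V s ac by auto
    obtain S' where S': "cluster S'" "{a,c,d,e,f} \<subseteq> S'"
      using cluster_cycle5[of a c d e f] D V s ac by auto
    show False by (rule no[of S S' a c]) (use S S' D in auto)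
  next
    assume "{a,d} \<in> E"
    then have ad: "shares a d" "shares d a" using sh[of a d] sh[of d a] by (auto simp: insert_commute)
    obtain S where S: "cluster S" "{a,b,c,d} \<subseteq> S"
      using cluster_cycle4[of a b c d] D V s ad by auto
    obtain S' where S': "cluster S'" "{a,d,e,f} \<subseteq> S'"
      using cluster_cycle4[of a d e f] D V s ad by auto
    show False by (rule no[of S S' a d]) (use S S' D in auto)
  qed
qed

end

section \<open>The doubled triangle and its cells\<close>

datatype dir = Hor | Ver | Dia
text \<open>
  \<open>Up s i j\<close> has the corners \<open>(i, j)\<close>, \<open>(i + 1, j)\<close>, \<open>(i, j + 1)\<close> in lattice coordinates, and \<open>Dn s i j\<close> has
  the corners \<open>(i + 1, j + 1)\<close>, \<open>(i, j + 1)\<close>, \<open>(i + 1, j)\<close>; the flag \<open>s\<close> is true on the back sheet.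
  Every side of a cell is a side of exactly one upward cell of its sheet, so \<open>Mid d s i j\<close>, the midpoint of the
  side \<open>d\<close> of \<open>Up s i j\<close>, covers all sides; a side on the boundary gets the flag of the front sheet. Inside
  a cell \<open>c\<close> there are up to two further vertices, \<open>Inn False c\<close> and \<open>Inn True c\<close>. A spot names one of the five
  possible vertices of a cell from inside the cell.
\<close>

datatype cell = Up bool int int | Dn bool int int
datatype vertex = Mid dir bool int int | Inn bool cell
datatype spot = Side dir | Core bool

instance dir :: countable by countable_datatype
instance cell :: countable by countable_datatype
instance vertex :: countable by countable_datatype

text \<open>
  The downward cell on the other side of the side \<open>d\<close> of \<open>Up s i j\<close>, if that side is not on the boundary.
\<close>

fun under :: "dir \<Rightarrow> bool \<Rightarrow> int \<Rightarrow> int \<Rightarrow> cell" where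
  "under Hor s i j = Dn s i (j - 1)"
| "under Ver s i j = Dn s (i - 1) j"
| "under Dia s i j = Dn s i j"

fun black :: "cell \<Rightarrow> bool" where
  "black (Up s i j) = (\<not> s)"
| "black (Dn s i j) = s"

abbreviation "outer_links \<equiv> {(Side Hor, Side Ver), (Side Hor, Side Dia), (Side Ver, Side Dia)}"
abbreviation "core_links \<equiv> {(Core False, Side Hor), (Core False, Side Ver), (Core False, Side Dia)}"
abbreviation "extra_links \<equiv> {(Core True, Core False), (Core True, Side Hor), (Core True, Side Ver)}"

locale folded_triangle =
  fixes m :: int
  assumes m_pos: "1 \<le> m"
begin

fun rim :: "dir \<Rightarrow> int \<Rightarrow> int \<Rightarrow> bool" where
  "rim Hor i j \<longleftrightarrow> j = - m"
| "rim Ver i j \<longleftrightarrow> i = - m"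
| "rim Dia i j \<longleftrightarrow> i + j = m - 1"

definition corner :: "int \<Rightarrow> int \<Rightarrow> bool" where
  "corner i j \<longleftrightarrow> rim Hor i j \<and> rim Ver i j \<or> rim Hor i j \<and> rim Dia i j \<or> rim Ver i j \<and> rim Dia i j"

fun cell_ok :: "cell \<Rightarrow> bool" where
  "cell_ok (Up s i j) \<longleftrightarrow> - m \<le> i \<and> - m \<le> j \<and> i + j < m"
| "cell_ok (Dn s i j) \<longleftrightarrow> - m \<le> i \<and> - m \<le> j \<and> i + j < m - 1"

fun vertex_at :: "cell \<Rightarrow> spot \<Rightarrow> vertex" where
  "vertex_at (Up s i j) (Side d) = Mid d (s \<and> \<not> rim d i j) i j"
| "vertex_at (Dn s i j) (Side Hor) = Mid Hor s i (j + 1)"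
| "vertex_at (Dn s i j) (Side Ver) = Mid Ver s (i + 1) j"
| "vertex_at (Dn s i j) (Side Dia) = Mid Dia s i j"
| "vertex_at c (Core t) = Inn t c"


text \<open>
  The pairs of adjacent spots. In an ordinary cell the pair of \<open>Core True\<close> and \<open>Side Dia\<close> is the missing
  edge of the complete graph on the five spots. At a corner, the midpoints of the two boundary sides
  are already joined in the front cell; the back cell only joins its third midpoint to each of them.
\<close>

fun links :: "cell \<Rightarrow> (spot \<times> spot) set" where
  "links (Up s i j) =
    (if \<not> corner i j then outer_links \<union> core_links \<union> extra_links
     else if \<not> s then outer_links \<union> core_links
     else if \<not> rim Dia i j then {(Side Hor, Side Dia), (Side Ver, Side Dia)}
     else if \<not> rim Ver i j then {(Side Hor, Side Ver), (Side Ver, Side Dia)}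
     else {(Side Hor, Side Ver), (Side Hor, Side Dia)})"
| "links (Dn s i j) = outer_links \<union> core_links \<union> extra_links"

fun vertex_ok :: "vertex \<Rightarrow> bool" where
  "vertex_ok (Mid d s i j) \<longleftrightarrow> - m \<le> i \<and> - m \<le> j \<and> i + j < m \<and> \<not> (s \<and> rim d i j)"
| "vertex_ok (Inn t (Up s i j)) \<longleftrightarrow> cell_ok (Up s i j) \<and> (corner i j \<longrightarrow> \<not> s \<and> \<not> t)"
| "vertex_ok (Inn t (Dn s i j)) \<longleftrightarrow> cell_ok (Dn s i j)"

definition verts :: "vertex set" where "verts = Collect vertex_ok"

definition edge :: "cell \<Rightarrow> spot \<times> spot \<Rightarrow> vertex set" where
  "edge c l = {vertex_at c (fst l), vertex_at c (snd l)}"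

definition edge_index :: "(cell \<times> (spot \<times> spot)) set" where
  "edge_index = (SIGMA c:Collect cell_ok. links c)"

definition edges :: "vertex set set" where
  "edges = (\<lambda>(c, l). edge c l) ` edge_index"

text \<open>
  An inner vertex belongs to one cell only; its other label is a fresh value of its own.
\<close>

fun black_label :: "vertex \<Rightarrow> cell + vertex" where
  "black_label (Mid d s i j) = Inl (if s then under d s i j else Up False i j)"
| "black_label (Inn t c) = (if black c then Inl c else Inr (Inn t c))"

fun white_label :: "vertex \<Rightarrow> cell + vertex" where
  "white_label (Mid d s i j) = Inl (if s \<or> rim d i j then Up True i j else under d s i j)"
| "white_label (Inn t c) = (if black c then Inr (Inn t c) else Inl c)"

lemma corner_not_all: "\<not> (rim Hor i j \<and> rim Ver i j \<and> rim Dia i j)"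
  using m_pos by auto

lemma label_vertex_at:
  assumes "cell_ok c"
  shows "if black c then black_label (vertex_at c u) = Inl c else white_label (vertex_at c u) = Inl c"
  using assms
  by (cases "(c, u)" rule: vertex_at.cases) auto

lemma edge_subset:
  assumes "cell_ok c" "l \<in> links c"
  shows "edge c l \<subseteq> verts"
  using assms by (cases c) (auto simp: edge_def verts_def split: if_splits)

text \<open>
  The two vertices are midpoints of common sides of the same two cells, and only the front and back cell
  at a corner have more than one common side.
\<close>

lemma twins_at_corner:
  assumes "vertex_ok u" "vertex_ok v" "u \<noteq> v" "black_label u = black_label v" "white_label u = white_label v"
  shows "\<exists>i j d e. corner i j \<and> d \<noteq> e \<and> u = Mid d False i j \<and> v = Mid e False i j \<and> rim d i j \<and> rim e i j"
proof (cases u; cases v)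
  fix d s i j e t k l
  assume uv: "u = Mid d s i j" "v = Mid e t k l"
  show ?thesis using assms unfolding uv corner_def
    by (cases d; cases e; cases s; cases t) (auto split: if_splits)
next
qed (use assms in \<open>auto split: if_splits\<close>)

definition adjacent_cells :: "cell \<Rightarrow> cell \<Rightarrow> bool" where
  "adjacent_cells b w \<longleftrightarrow> (\<exists>i j. b = Up False i j \<and> w = Up True i j) \<or>
     (\<exists>d i j. b = Up False i j \<and> w = under d False i j) \<or>
     (\<exists>d i j. b = under d True i j \<and> w = Up True i j)"

lemma Mid_adjacent_cells:
  assumes "vertex_ok (Mid d s i j)"
  shows "\<exists>b w. black_label (Mid d s i j) = Inl b \<and> white_label (Mid d s i j) = Inl w \<and> adjacent_cells b w"
  using assms by (auto simp: adjacent_cells_def)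

lemma under_shape: "\<exists>k l. under d s i j = Dn s k l"
  by (cases d) auto

text \<open>
  Two upward cells have at most one neighbour in common, since the three neighbours of a cell lie in
  three different directions.
\<close>

lemma under_common:
  assumes "under d s i j = under e s k l" "under d' s i j = under e' s k l"
  shows "(i = k \<and> j = l) \<or> under d s i j = under d' s i j"
  using assms by (cases d; cases e; cases d'; cases e') simp_all

lemma adjacent_cells_Up: "adjacent_cells (Up s i j) w \<longleftrightarrow> \<not> s \<and> (w = Up True i j \<or> (\<exists>d. w = under d False i j))"
proof -
  have "Up s i j \<noteq> under d True k l" for d k l using under_shape[of d True k l] by auto
  then show ?thesis unfolding adjacent_cells_def by blast
qed

lemma adjacent_cells_Dn:
  assumes "adjacent_cells (Dn s i j) w"
  shows "\<exists>d k l. Dn s i j = under d True k l \<and> w = Up True k l"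
  using assms unfolding adjacent_cells_def by blast

text \<open>
  A 4-cycle of cells cannot cross the boundary between the sheets, because an upward cell has only one
  neighbour on the other sheet; within a sheet \<open>under_common\<close> applies.
\<close>

lemma adjacent_cells_no_4_cycle:
  assumes "adjacent_cells b w'" "adjacent_cells b w" "adjacent_cells b' w" "adjacent_cells b' w'"
  shows "b = b' \<or> w = w'"
proof (cases b)
  case b: (Up s i j)
  show ?thesis
  proof (cases b')
    case b': (Up s' k l)
    have s: "\<not> s" "\<not> s'" using assms(2,3) unfolding b b' adjacent_cells_Up by blast+
    have no: "Up True x y \<noteq> under d False z z'" for d x y z z'
      using under_shape[of d False z z'] by auto
    consider "i = k \<and> j = l" | d e d' e' where "w = under d False i j" "w = under e False k l"
        "w' = under d' False i j" "w' = under e' False k l"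
      using assms unfolding b b' adjacent_cells_Up by (metis no cell.inject(1))
    then show ?thesis
    proof cases
      case 1
      then show ?thesis using s b b' by simp
    next
      case 2
      then show ?thesis using under_common[of d False i j e k l d' e'] s b b' by auto
    qed
  next
    case b': (Dn s' k l)
    have "w = Up True i j" if h: "adjacent_cells (Up s i j) w" "adjacent_cells (Dn s' k l) w" for w
    proof -
      obtain x y where "w = Up True x y" using adjacent_cells_Dn[OF h(2)] by blast
      moreover have "w \<noteq> under d False i j" for d using calculation under_shape[of d False i j] by auto
      ultimately show ?thesis using h(1) unfolding adjacent_cells_Up by blast
    qed
    then show ?thesis using assms b b' by metis
  qed
next
  case b: (Dn s i j)
  obtain d x y where 1: "b = under d True x y" "w = Up True x y" using adjacent_cells_Dn assms(2) b by blast
  obtain d' x' y' where 2: "b = under d' True x' y'" "w' = Up True x' y'" using adjacent_cells_Dn assms(1) b by blast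
  have "\<exists>e. b' = under e True z z' \<or> b' = Up False z z'" if "adjacent_cells b' (Up True z z')" for z z'
  proof (cases b')
    case (Up t k l)
    have "Up True z z' \<noteq> under d False k l" for d using under_shape[of d False k l] by auto
    then show ?thesis using that unfolding Up adjacent_cells_Up by simp
  next
    case (Dn t k l)
    then show ?thesis using adjacent_cells_Dn that by blast
  qed
  then obtain e e' where "b' = under e True x y \<or> b' = Up False x y" "b' = under e' True x' y' \<or> b' = Up False x' y'"
    using assms(3,4) 1 2 by meson
  moreover have "Up False p q \<noteq> under e True z z'" for e p q z z' using under_shape[of e True z z'] by auto
  ultimately consider "x = x' \<and> y = y'" | "b' = under e True x y" "b' = under e' True x' y'"
    by (metis cell.inject(1))
  then show ?thesis
  proof cases
    case 2
    then show ?thesis using under_common[of d True x y d' x' y' e e'] 1 \<open>b = under d' True x' y'\<close> \<open>w' = _\<close> by auto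
  qed (use 1 2 in simp)
qed

text \<open>
  An inner vertex shares its private label with no other vertex, so only midpoints matter.
\<close>

lemma labels_no_4_cycle:
  assumes ok: "vertex_ok t" "vertex_ok u" "vertex_ok v" "vertex_ok w"
    and eq: "black_label t = black_label u" "white_label u = white_label v" "black_label v = black_label w" "white_label w = white_label t"
  shows "black_label u = black_label v \<or> white_label v = white_label w"
proof (cases "\<exists>x c. x \<in> {t, u, v, w} \<and> (\<exists>k. x = Inn k c)")
  case True
  have B: "Inn k c = y" if "black_label (Inn k c) = black_label y" "\<not> black c" for k c y
    using that by (cases y) (auto split: if_splits)
  have W: "Inn k c = y" if "white_label (Inn k c) = white_label y" "black c" for k c y
    using that by (cases y) (auto split: if_splits)
  from True obtain k c where "t = Inn k c \<or> u = Inn k c \<or> v = Inn k c \<or> w = Inn k c" by auto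
  then show ?thesis
    using eq eq[symmetric] B[of k c] W[of k c] by (elim disjE; cases "black c") metis+
next
  case False
  have mid: "\<exists>d s i j. x = Mid d s i j" if "x \<in> {t, u, v, w}" for x
    using False that by (cases x) blast+
  obtain b1 w1 where 1: "black_label t = Inl b1" "white_label t = Inl w1" "adjacent_cells b1 w1"
    using mid[of t] Mid_adjacent_cells ok by blast
  obtain b2 w2 where 2: "black_label u = Inl b2" "white_label u = Inl w2" "adjacent_cells b2 w2"
    using mid[of u] Mid_adjacent_cells ok by blast
  obtain b3 w3 where 3: "black_label v = Inl b3" "white_label v = Inl w3" "adjacent_cells b3 w3"
    using mid[of v] Mid_adjacent_cells ok by blast
  obtain b4 w4 where 4: "black_label w = Inl b4" "white_label w = Inl w4" "adjacent_cells b4 w4"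
    using mid[of w] Mid_adjacent_cells ok by blast
  have e: "b1 = b2" "w2 = w3" "b3 = b4" "w4 = w1" using eq 1 2 3 4 by simp_all
  have "b2 = b3 \<or> w3 = w4" using adjacent_cells_no_4_cycle[of b2 w1 w2 b3] 1 2 3 4 unfolding e by auto
  then show ?thesis using 2 3 4 by simp
qed

end

section \<open>Short cycles and the number of vertices and edges\<close>

lemma UNIV_dir: "(UNIV :: dir set) = {Hor, Ver, Dia}"
  using dir.exhaust by blast

lemma UNIV_spot: "(UNIV :: spot set) = {Side Hor, Side Ver, Side Dia, Core False, Core True}"
proof -
  have "x \<in> {Side Hor, Side Ver, Side Dia, Core False, Core True}" for x
  proof (cases x)
    case (Side d)
    then show ?thesis by (cases d) simp_all
  next
    case (Core b)
    then show ?thesis by (cases b) simp_all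
  qed
  then show ?thesis by blast
qed

context folded_triangle
begin

lemma labelled_vertex_at:
  assumes "vertex_ok v" "black_label v = Inl c \<or> white_label v = Inl c"
  shows "v \<in> range (vertex_at c)"
proof (cases v)
  case (Mid d s i j)
  have "v = vertex_at c (Side d)"
    using assms unfolding Mid by (cases d; cases s) (auto split: if_splits)
  then show ?thesis by blast
next
  case (Inn t c')
  then have "c' = c" using assms(2) by (auto split: if_splits)
  then have "v = vertex_at c (Core t)" using Inn by (cases c) simp_all
  then show ?thesis by blast
qed

lemma card_range_vertex_at: "finite (range (vertex_at c))" "card (range (vertex_at c)) \<le> 5"
proof -
  show "finite (range (vertex_at c))" unfolding UNIV_spot by simp
  have "card (range (vertex_at c)) \<le> card (UNIV :: spot set)"
    by (rule card_image_le) (simp add: UNIV_spot)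
  then show "card (range (vertex_at c)) \<le> 5" by (simp add: UNIV_spot)
qed

lemma card_le_5_subsingleton: "(\<And>x y. x \<in> A \<Longrightarrow> y \<in> A \<Longrightarrow> x = y) \<Longrightarrow> card A \<le> 5"
  by (metis One_nat_def card_le_Suc0_iff_eq card.infinite le_trans one_le_numeral zero_le)

lemma card_black_fibre: "card {v \<in> verts. black_label v = x} \<le> 5"
proof (cases x)
  case (Inl c)
  have "{v \<in> verts. black_label v = x} \<subseteq> range (vertex_at c)" using labelled_vertex_at Inl unfolding verts_def by blast
  then show ?thesis using card_range_vertex_at[of c] by (meson card_mono le_trans)
next
  case (Inr y)
  have "v = y" if "black_label v = x" for v using that Inr by (cases v) (auto split: if_splits)
  then show ?thesis by (intro card_le_5_subsingleton) blast
qed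

lemma card_white_fibre: "card {v \<in> verts. white_label v = x} \<le> 5"
proof (cases x)
  case (Inl c)
  have "{v \<in> verts. white_label v = x} \<subseteq> range (vertex_at c)" using labelled_vertex_at Inl unfolding verts_def by blast
  then show ?thesis using card_range_vertex_at[of c] by (meson card_mono le_trans)
next
  case (Inr y)
  have "v = y" if "white_label v = x" for v using that Inr by (cases v) (auto split: if_splits)
  then show ?thesis by (intro card_le_5_subsingleton) blast
qed

text \<open>
  The cells at a corner share two midpoints. Each has one more midpoint, and only the front cell has an
  inner vertex.
\<close>

lemma card_twin_fibre:
  assumes "vertex_ok u" "vertex_ok v" "u \<noteq> v" "black_label u = black_label v" "white_label u = white_label v"
  shows "card {w \<in> verts. black_label w = black_label u \<or> white_label w = white_label u} \<le> 5"
proof -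
  obtain i j d e where c: "corner i j" "d \<noteq> e" "u = Mid d False i j" "rim d i j" "rim e i j"
    using twins_at_corner[OF assms] by blast
  obtain f where f: "\<And>g. g = f \<or> rim g i j"
    using c(2,4,5) by (cases d; cases e) (metis dir.exhaust)+
  let ?S = "{Inn False (Up False i j), Mid f True i j, Mid Hor False i j, Mid Ver False i j, Mid Dia False i j}"
  have "w \<in> ?S" if w: "vertex_ok w" "black_label w = black_label u \<or> white_label w = white_label u" for w
  proof -
    have "black_label w = Inl (Up False i j) \<or> white_label w = Inl (Up True i j)"
      using w(2) c(3,4) by simp
    then obtain s x where x: "w = vertex_at (Up s i j) x" using labelled_vertex_at[OF w(1)] by blast
    show ?thesis
    proof (cases x)
      case (Side g)
      then show ?thesis using x f[of g] by (cases g) auto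
    next
      case (Core t)
      then show ?thesis using x w(1) c(1) by simp
    qed
  qed
  then have "{w \<in> verts. black_label w = black_label u \<or> white_label w = white_label u} \<subseteq> ?S" unfolding verts_def by blast
  moreover have "card ?S \<le> 5" by (rule order_trans[OF card_insert_le_m1]) (auto simp: card_insert_if)
  ultimately show ?thesis by (meson card_mono finite.intros le_trans)
qed

lemma twins_unique:
  assumes ok: "vertex_ok t" "vertex_ok u" "vertex_ok v" "vertex_ok w"
    and tu: "t \<noteq> u" "black_label t = black_label u" "white_label t = white_label u"
    and vw: "v \<noteq> w" "black_label v = black_label w" "white_label v = white_label w"
    and eq: "black_label t = black_label v \<or> white_label t = white_label v"
  shows "{t, u} = {v, w}"
proof -
  obtain i j d e where 1: "d \<noteq> e" "t = Mid d False i j" "u = Mid e False i j" "rim d i j" "rim e i j"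
    using twins_at_corner[OF ok(1,2) tu] by blast
  obtain k l d' e' where 2: "d' \<noteq> e'" "v = Mid d' False k l" "w = Mid e' False k l" "rim d' k l" "rim e' k l"
    using twins_at_corner[OF ok(3,4) vw] by blast
  have "k = i" "l = j" using eq 1 2 by auto
  moreover have "{d, e} = {d', e'}"
    using 1(1,4,5) 2(1,4,5) corner_not_all[of i j] unfolding \<open>k = i\<close> \<open>l = j\<close>
    by (cases d; cases e; cases d'; cases e') (simp_all only: simp_thms insert_commute dir.distinct refl)
  ultimately show ?thesis using 1(2,3) 2(2,3) by (auto simp: doubleton_eq_iff)
qed

lemma edges_share:
  assumes "{u, v} \<in> edges"
  shows "black_label u = black_label v \<or> white_label u = white_label v"
proof -
  obtain c a b where c: "cell_ok c" "{u, v} = {vertex_at c a, vertex_at c b}"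
    using assms unfolding edges_def edge_index_def edge_def by auto
  then show ?thesis using label_vertex_at[OF c(1), of a] label_vertex_at[OF c(1), of b]
    by (cases "black c") (auto simp: doubleton_eq_iff)
qed

lemma edges_subset: "e \<in> edges \<Longrightarrow> e \<subseteq> verts"
  unfolding edges_def edge_index_def using edge_subset by auto

lemma vertex_at_inj:
  assumes "vertex_at c a = vertex_at c b"
  shows "a = b"
proof (cases c)
  case (Up s i j)
  then show ?thesis using assms by (cases a; cases b) simp_all
next
  case (Dn s i j)
  then show ?thesis using assms
    by (cases "(c, a)" rule: vertex_at.cases; cases "(c, b)" rule: vertex_at.cases) simp_all
qed

lemma links_asym: "(a, b) \<in> links c \<Longrightarrow> a \<noteq> b \<and> (b, a) \<notin> links c"
  by (cases c) (auto split: if_splits)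

lemma back_corner_links:
  assumes "(Side d, Side e) \<in> links (Up True i j)" "rim d i j" "rim e i j"
  shows False
  using assms corner_not_all[of i j] unfolding corner_def
  by (cases d; cases e) (simp_all split: if_splits del: rim.simps add: corner_def)

text \<open>
  The two ends of an edge determine the cell: otherwise they would be twins at a corner, and
  the back cell has no edge between these.
\<close>

lemma edge_inj:
  assumes c: "cell_ok c" "l \<in> links c" and c': "cell_ok c'" "l' \<in> links c'"
    and eq: "edge c l = edge c' l'"
  shows "c = c' \<and> l = l'"
proof -
  obtain a b where l: "l = (a, b)" by force
  obtain a' b' where l': "l' = (a', b')" by force
  have e: "{vertex_at c a, vertex_at c b} = {vertex_at c' a', vertex_at c' b'}" using eq unfolding edge_def l l' by simp
  have ab: "a \<noteq> b" "(b, a) \<notin> links c" using links_asym c(2) unfolding l by blast+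
  have clash: False
    if cell: "cell_ok c" "cell_ok c'" "black c" "\<not> black c'"
      and h: "a \<noteq> b" "(a, b) \<in> links c" "(a', b') \<in> links c'"
      and e: "{vertex_at c a, vertex_at c b} = {vertex_at c' a', vertex_at c' b'}" for c c' a b a' b'
  proof -
    let ?u = "vertex_at c a" and ?v = "vertex_at c b"
    have bl: "black_label ?u = Inl c" "black_label ?v = Inl c"
      using label_vertex_at[OF cell(1), of a] label_vertex_at[OF cell(1), of b] cell(3) by auto
    have wc: "white_label (vertex_at c' x) = Inl c'" for x using label_vertex_at[OF cell(2), of x] cell(4) by simp
    have wl: "white_label ?u = Inl c'" "white_label ?v = Inl c'" using e wc by (metis insert_iff singletonD)+
    have ok: "vertex_ok ?u" "vertex_ok ?v"
      using edge_subset[OF cell(1) h(2)] unfolding edge_def verts_def by auto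
    have "?u \<noteq> ?v" using vertex_at_inj h(1) by blast
    then obtain i j d f where t: "?u = Mid d False i j" "?v = Mid f False i j" "rim d i j" "rim f i j"
      using twins_at_corner[OF ok] bl wl by metis
    have c': "c' = Up True i j" using wl(1) t(1,3) by simp
    have side: "x = Side g" if "vertex_at c' x = Mid g False i j" for x g
      using that unfolding c' by (cases x) simp_all
    have "(a' = Side d \<and> b' = Side f) \<or> (a' = Side f \<and> b' = Side d)"
      using e side unfolding t(1,2) by (metis doubleton_eq_iff)
    then show False using back_corner_links h(3) t(3,4) unfolding c' by blast
  qed
  have "black c = black c'"
    using clash[of c c' a b a' b'] clash[of c' c a' b' a b] c c' e links_asym unfolding l l' by metis
  moreover have "vertex_at c a \<in> {vertex_at c' a', vertex_at c' b'}" using e by blast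
  ultimately have cc: "c = c'"
    using label_vertex_at[OF c(1), of a] label_vertex_at[OF c'(1), of a'] label_vertex_at[OF c'(1), of b']
    by (cases "black c") auto
  have "{a, b} = {a', b'}" using e vertex_at_inj[of c] unfolding cc by (metis doubleton_eq_iff)
  then have "a = a' \<and> b = b'"
    using links_asym[of a b c] c(2) c'(2) unfolding cc l l' by (auto simp: doubleton_eq_iff)
  then show ?thesis using cc l l' by simp
qed

definition up_cells :: "(int \<times> int) set" where
  "up_cells = {(i, j). - m \<le> i \<and> - m \<le> j \<and> i + j < m}"

definition down_cells :: "(int \<times> int) set" where
  "down_cells = {(i, j). - m \<le> i \<and> - m \<le> j \<and> i + j < m - 1}"

definition corners :: "(int \<times> int) set" where
  "corners = {(- m, - m), (2 * m - 1, - m), (- m, 2 * m - 1)}"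

lemma corners: "{p \<in> up_cells. corner (fst p) (snd p)} = corners" "card corners = 3" "corners \<subseteq> up_cells"
  using m_pos by (auto simp: corners_def up_cells_def corner_def)

lemma corners_iff: "(i, j) \<in> corners \<longleftrightarrow> (i, j) \<in> up_cells \<and> corner i j"
  unfolding corners(1)[symmetric] by simp

text \<open>
  The triangle of side \<open>k + 1\<close> is the triangle of side \<open>k\<close> with one diagonal added.
\<close>

lemma card_triangle:
  fixes a :: int and k :: nat
  shows "finite {(i, j). a \<le> i \<and> a \<le> j \<and> i + j < 2 * a + int k}"
    and "2 * card {(i, j). a \<le> i \<and> a \<le> j \<and> i + j < 2 * a + int k} = k * (k + 1)"
proof -
  have *: "{(i, j). a \<le> i \<and> a \<le> j \<and> i + j < 2 * a + int k} = (SIGMA i:{a..<a + int k}. {a..<2 * a + int k - i})"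
    by auto
  show "finite {(i, j). a \<le> i \<and> a \<le> j \<and> i + j < 2 * a + int k}" unfolding * by blast
  show "2 * card {(i, j). a \<le> i \<and> a \<le> j \<and> i + j < 2 * a + int k} = k * (k + 1)"
  proof (induction k)
    case 0
    have "{(i, j). a \<le> i \<and> a \<le> j \<and> i + j < 2 * a} = {}" by auto
    then have "card {(i, j). a \<le> i \<and> a \<le> j \<and> i + j < 2 * a} = 0" by (simp only: card.empty)
    then show ?case by simp
  next
    case (Suc k)
    let ?T = "\<lambda>k. {(i, j). a \<le> i \<and> a \<le> j \<and> i + j < 2 * a + int k}"
    let ?D = "(\<lambda>i. (i, 2 * a + int k - i)) ` {a..a + int k}"
    have "?T (Suc k) = ?T k \<union> ?D" by (auto simp: image_iff)
    moreover have "?T k \<inter> ?D = {}" by auto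
    moreover have "finite (?T k)"
    proof -
      have "?T k = (SIGMA i:{a..<a + int k}. {a..<2 * a + int k - i})" by auto
      then show ?thesis by simp
    qed
    moreover have "card ?D = k + 1" by (subst card_image) (auto simp: inj_on_def)
    ultimately have "card (?T (Suc k)) = card (?T k) + (k + 1)" by (simp add: card_Un_disjoint)
    then show ?case using Suc by simp
  qed
qed

lemma card_up_cells: "finite up_cells" "2 * int (card up_cells) = 3 * m * (3 * m + 1)"
proof -
  have *: "up_cells = {(i, j). - m \<le> i \<and> - m \<le> j \<and> i + j < 2 * - m + int (nat (3 * m))}"
    unfolding up_cells_def using m_pos by auto
  show "finite up_cells" unfolding * by (rule card_triangle)
  have "int (2 * card up_cells) = int (nat (3 * m) * (nat (3 * m) + 1))"
    unfolding * by (subst card_triangle(2)) (rule refl)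
  then show "2 * int (card up_cells) = 3 * m * (3 * m + 1)" using m_pos by (simp add: algebra_simps)
qed

lemma card_down_cells: "finite down_cells" "2 * int (card down_cells) = (3 * m - 1) * (3 * m)"
proof -
  have *: "down_cells = {(i, j). - m \<le> i \<and> - m \<le> j \<and> i + j < 2 * - m + int (nat (3 * m - 1))}"
    unfolding down_cells_def using m_pos by auto
  show "finite down_cells" unfolding * by (rule card_triangle)
  have "int (2 * card down_cells) = int (nat (3 * m - 1) * (nat (3 * m - 1) + 1))"
    unfolding * by (subst card_triangle(2)) (rule refl)
  then show "2 * int (card down_cells) = (3 * m - 1) * (3 * m)" using m_pos by (simp add: algebra_simps)
qed

lemma card_up_down: "int (card up_cells) + int (card down_cells) = 9 * m\<^sup>2"
  using card_up_cells(2) card_down_cells(2) by (simp add: algebra_simps power2_eq_square)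

text \<open>
  Front midpoints correspond to sides of upward cells; back midpoints, none of which is on the boundary,
  to sides of downward cells. Of the four pairs (inner vertex, sheet) all but one are absent at a corner, so
  nine inner vertices are missing in total.
\<close>

lemma card_verts: "finite verts" "int (card verts) = 63 * m\<^sup>2 - 9"
proof -
  let ?D = "UNIV :: dir set" and ?b = "UNIV :: bool set"
  let ?bad = "{(True, False), (False, True), (True, True)} \<times> corners"
  let ?A1 = "(\<lambda>(d, i, j). Mid d False i j) ` (?D \<times> up_cells)"
  let ?A2 = "(\<lambda>(d, i, j). vertex_at (Dn True i j) (Side d)) ` (?D \<times> down_cells)"
  let ?A3 = "(\<lambda>(t, s, i, j). Inn t (Dn s i j)) ` (?b \<times> ?b \<times> down_cells)"
  let ?A4 = "(\<lambda>((t, s), (i, j)). Inn t (Up s i j)) ` ((?b \<times> ?b) \<times> up_cells - ?bad)"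
  have sub: "v \<in> ?A1 \<union> ?A2 \<union> ?A3 \<union> ?A4" if v: "vertex_ok v" for v
    using v
  proof (cases v rule: vertex_ok.cases)
    case (1 d s i j)
    show ?thesis
    proof (cases s)
      case False
      then show ?thesis using v unfolding 1 by (auto simp: up_cells_def image_iff)
    next
      case True
      obtain k l where kl: "under d True i j = Dn True k l" using under_shape by blast
      then have "v = vertex_at (Dn True k l) (Side d) \<and> (k, l) \<in> down_cells"
        using v True unfolding 1 by (cases d) (auto simp: down_cells_def)
      then have "v \<in> ?A2" by (intro image_eqI[where x = "(d, k, l)"]) simp_all
      then show ?thesis by blast
    qed
  next
    case (2 t s i j)
    then have "(i, j) \<in> up_cells" using v by (simp add: up_cells_def)
    moreover have "((t, s), (i, j)) \<notin> ?bad"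
      using v unfolding 2 by (auto simp: corners_iff)
    ultimately have "((t, s), (i, j)) \<in> (?b \<times> ?b) \<times> up_cells - ?bad" by auto
    then show ?thesis unfolding 2 by (intro UnI2 image_eqI[where x = "((t, s), (i, j))"]) auto
  next
    case (3 t s i j)
    then show ?thesis using v by (auto simp: down_cells_def image_iff)
  qed
  have sup: "vertex_ok v" if "v \<in> ?A1 \<union> ?A2 \<union> ?A3 \<union> ?A4" for v
  proof -
    show ?thesis
      using that
    proof (elim UnE)
      assume "v \<in> ?A1"
      then show ?thesis by (auto simp: up_cells_def)
    next
      assume "v \<in> ?A2"
      then obtain d i j where "v = vertex_at (Dn True i j) (Side d)" "(i, j) \<in> down_cells" by auto
      then show ?thesis by (cases d) (auto simp: down_cells_def)
    next
      assume "v \<in> ?A3"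
      then show ?thesis by (auto simp: down_cells_def)
    next
      assume "v \<in> ?A4"
      then obtain t s i j where "v = Inn t (Up s i j)" "((t, s), (i, j)) \<in> (?b \<times> ?b) \<times> up_cells - ?bad"
        by (elim imageE) (metis (no_types, lifting) case_prod_conv surj_pair)
      then show ?thesis by (cases t; cases s) (auto simp: corners_iff up_cells_def)
    qed
  qed
  have V: "verts = ?A1 \<union> ?A2 \<union> ?A3 \<union> ?A4"
    unfolding verts_def set_eq_iff mem_Collect_eq by (intro allI iffI) (erule sub, erule sup)
  have finD: "finite ?D" by (simp only: UNIV_dir finite.intros)
  have fin: "finite ?A1" "finite ?A2" "finite ?A3" "finite ?A4"
    using card_up_cells(1) card_down_cells(1) finD
    by (intro finite_imageI finite_cartesian_product finite_Diff finite; simp)+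
  show "finite verts" unfolding V using fin by blast
  have dir3: "card ?D = 3" unfolding UNIV_dir by simp
  have c1: "card ?A1 = 3 * card up_cells"
    by (subst card_image) (auto simp: inj_on_def card_cartesian_product dir3)
  have back_side_inj: "d = e \<and> i = k \<and> j = l" if "vertex_at (Dn True i j) (Side d) = vertex_at (Dn True k l) (Side e)" for d i j e k l
    using that by (cases d; cases e) simp_all
  have "inj_on (\<lambda>(d, i, j). vertex_at (Dn True i j) (Side d)) (?D \<times> down_cells)"
    by (rule inj_onI) (auto dest: back_side_inj)
  then have c2: "card ?A2 = 3 * card down_cells"
    by (subst card_image) (auto simp: card_cartesian_product dir3)
  have c3: "card ?A3 = 4 * card down_cells"
    by (subst card_image) (auto simp: inj_on_def card_cartesian_product)
  have "card ((?b \<times> ?b) \<times> up_cells - ?bad) = 4 * card up_cells - 9"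
  proof -
    have "finite ?bad" using finite_subset[OF corners(3) card_up_cells(1)] by simp
    moreover have "?bad \<subseteq> (?b \<times> ?b) \<times> up_cells" using corners(3) by blast
    ultimately have "card ((?b \<times> ?b) \<times> up_cells - ?bad) = card ((?b \<times> ?b) \<times> up_cells) - card ?bad"
      by (rule card_Diff_subset)
    then show ?thesis by (simp add: card_cartesian_product corners(2))
  qed
  then have c4: "card ?A4 = 4 * card up_cells - 9"
    by (subst card_image) (auto simp: inj_on_def)
  have "3 \<le> card up_cells" using card_mono[OF card_up_cells(1) corners(3)] corners(2) by simp
  have rear: "vertex_at (Dn True i j) (Side d) \<noteq> Mid e False k l" "vertex_at (Dn True i j) (Side d) \<noteq> Inn t c"
    for d e i j k l t c by (cases d; simp)+
  note rear' = rear[symmetric]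
  have "?A1 \<inter> ?A2 = {}" "(?A1 \<union> ?A2) \<inter> ?A3 = {}" "(?A1 \<union> ?A2 \<union> ?A3) \<inter> ?A4 = {}"
    by (auto simp: rear rear')
  then have "card verts = card ?A1 + card ?A2 + card ?A3 + card ?A4"
    unfolding V using fin by (simp add: card_Un_disjoint)
  then show "int (card verts) = 63 * m\<^sup>2 - 9"
    using c1 c2 c3 c4 card_up_down \<open>3 \<le> card up_cells\<close> by (simp add: of_nat_diff)
qed

lemma card_links:
  "card (links (Up s i j)) = (if \<not> corner i j then 9 else if s then 2 else 6)"
  "card (links (Dn s i j)) = 9"
  "finite (links c)"
proof -
  show "card (links (Up s i j)) = (if \<not> corner i j then 9 else if s then 2 else 6)"
    by (simp split: if_splits)
  show "card (links (Dn s i j)) = 9" by simp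
  show "finite (links c)" by (cases c) simp_all
qed

text \<open>
  A corner has \<open>6 + 2\<close> edges where two ordinary cells would have \<open>9 + 9\<close>.
\<close>

lemma card_edges: "int (card edges) = 162 * m\<^sup>2 - 30"
proof -
  let ?b = "UNIV :: bool set"
  let ?U = "(\<lambda>((i, j), s). Up s i j) ` (up_cells \<times> ?b)" and ?D = "(\<lambda>((i, j), s). Dn s i j) ` (down_cells \<times> ?b)"
  have "cell_ok c \<longleftrightarrow> c \<in> ?U \<union> ?D" for c
    by (cases c) (auto simp: up_cells_def down_cells_def image_iff)
  then have cells: "Collect cell_ok = ?U \<union> ?D" by blast
  have fin: "finite ?U" "finite ?D" using card_up_cells(1) card_down_cells(1) by auto
  have "inj_on (\<lambda>(c, l). edge c l) edge_index"
    by (rule inj_onI) (use edge_inj in \<open>auto simp: edge_index_def\<close>)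
  then have "card edges = card edge_index" unfolding edges_def by (rule card_image)
  also have "\<dots> = (\<Sum>c\<in>Collect cell_ok. card (links c))"
    unfolding edge_index_def by (rule card_SigmaI) (use fin cells card_links(3) in auto)
  also have "\<dots> = (\<Sum>c\<in>?U. card (links c)) + (\<Sum>c\<in>?D. card (links c))"
    unfolding cells using fin by (intro sum.union_disjoint) auto
  also have "(\<Sum>c\<in>?D. card (links c)) = (\<Sum>p\<in>down_cells \<times> ?b. 9)"
    by (rule sum.reindex_cong[OF _ refl]) (auto simp: inj_on_def card_links simp del: links.simps)
  also have "\<dots> = 18 * card down_cells" by (simp add: card_cartesian_product)
  also have "(\<Sum>c\<in>?U. card (links c)) = (\<Sum>(p, s)\<in>up_cells \<times> ?b. card (links (Up s (fst p) (snd p))))"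
    by (rule sum.reindex_cong[OF _ refl]) (auto simp: inj_on_def simp del: links.simps)
  also have "\<dots> = (\<Sum>p\<in>up_cells. \<Sum>s\<in>?b. card (links (Up s (fst p) (snd p))))"
    by (rule sum.cartesian_product[symmetric])
  also have "\<dots> = (\<Sum>p\<in>up_cells. if corner (fst p) (snd p) then 8 else 18)"
    by (rule sum.cong) (simp_all add: UNIV_bool card_links del: links.simps)
  finally have e: "card edges = (\<Sum>p\<in>up_cells. if corner (fst p) (snd p) then 8 else 18) + 18 * card down_cells" .
  have "(\<Sum>p\<in>up_cells. if corner (fst p) (snd p) then 8 else 18) + 10 * card corners
      = (\<Sum>p\<in>up_cells. (if corner (fst p) (snd p) then 8 else 18) + (if corner (fst p) (snd p) then 10 else 0))"
    using card_up_cells(1) unfolding corners(1)[symmetric] sum.distrib by (simp add: sum.If_cases Int_def)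
  also have "\<dots> = (\<Sum>p\<in>up_cells. 18)" by (rule sum.cong) simp_all
  finally have "card edges + 30 = 18 * (card up_cells + card down_cells)" using e corners(2) by simp
  then have "int (card edges + 30) = int (18 * (card up_cells + card down_cells))" by (rule arg_cong)
  then have "int (card edges) + 30 = 18 * (int (card up_cells) + int (card down_cells))"
    by (simp only: of_nat_add of_nat_mult of_nat_numeral)
  then show ?thesis using card_up_down by simp
qed

lemma labelling: "bipartite_labelling verts edges black_label white_label"
proof (unfold_locales, goal_cases)
  case 1
  show ?case by (rule card_verts)
next
  case (2 e)
  then show ?case by (rule edges_subset)
next
  case (3 u v)
  then show ?case by (rule edges_share)
next
  case (4 t u v w)
  then show ?case unfolding verts_def mem_Collect_eq by (intro labels_no_4_cycle[of t u v w])
next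
  case (5 t u v w)
  then show ?case unfolding verts_def mem_Collect_eq by (intro twins_unique[of t u v w])
next
  case (6 x)
  show ?case by (rule card_black_fibre)
next
  case (7 x)
  show ?case by (rule card_white_fibre)
next
  case (8 u v)
  then show ?case unfolding verts_def mem_Collect_eq by (intro card_twin_fibre[of u v, unfolded verts_def mem_Collect_eq])
qed

end

section \<open>Charts of the cells and the radial flip\<close>

text \<open>
  The five spots in a cell with corners \<open>(0, 0)\<close>, \<open>(8, 0)\<close>, \<open>(0, 8)\<close>. The point of \<open>Core True\<close> lies inside the
  triangle formed by \<open>Core False\<close>, \<open>Side Hor\<close> and \<open>Side Ver\<close>.
\<close>

fun spot_pos :: "spot \<Rightarrow> real \<times> real" where
  "spot_pos (Side Hor) = (4, 0)"
| "spot_pos (Side Ver) = (0, 4)"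
| "spot_pos (Side Dia) = (4, 4)"
| "spot_pos (Core False) = (3, 3)"
| "spot_pos (Core True) = (3, 2)"

fun chart :: "cell \<Rightarrow> real \<times> real \<Rightarrow> real \<times> real" where
  "chart (Up s i j) (x, y) = (8 * of_int i + x, 8 * of_int j + y)"
| "chart (Dn s i j) (x, y) = (8 * of_int i + 8 - x, 8 * of_int j + 8 - y)"

fun cell_sheet :: "cell \<Rightarrow> bool" where
  "cell_sheet (Up s i j) = s"
| "cell_sheet (Dn s i j) = s"

fun vertex_sheet :: "vertex \<Rightarrow> bool" where
  "vertex_sheet (Mid d s i j) = s"
| "vertex_sheet (Inn t c) = cell_sheet c"

fun pos :: "vertex \<Rightarrow> real \<times> real" where
  "pos (Mid d s i j) = chart (Up s i j) (spot_pos (Side d))"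
| "pos (Inn t c) = chart c (spot_pos (Core t))"

definition link_pt :: "spot \<times> spot \<Rightarrow> real \<Rightarrow> real \<times> real" where
  "link_pt l = linepath (spot_pos (fst l)) (spot_pos (snd l))"

abbreviation "all_links \<equiv> outer_links \<union> core_links \<union> extra_links"

definition closed_tri :: "(real \<times> real) set" where
  "closed_tri = {(x, y). 0 \<le> x \<and> 0 \<le> y \<and> x + y \<le> 8}"

definition open_tri :: "(real \<times> real) set" where
  "open_tri = {(x, y). 0 < x \<and> 0 < y \<and> x + y < 8}"

text \<open>
  The triangle spanned by the midpoints of the sides contains all segments and avoids the corners of
  the cell; its points other than these midpoints lie in the open cell.
\<close>

definition medial_tri :: "(real \<times> real) set" where
  "medial_tri = {(x, y). x \<le> 4 \<and> y \<le> 4 \<and> 4 \<le> x + y}"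

lemma medial_closed: "medial_tri \<subseteq> closed_tri"
  by (auto simp: medial_tri_def closed_tri_def)

lemma spot_medial: "spot_pos u \<in> medial_tri"
  by (cases u rule: spot_pos.cases) (simp_all add: medial_tri_def)

lemma link_medial:
  assumes "0 \<le> t" "t \<le> 1"
  shows "link_pt l t \<in> medial_tri"
proof -
  have "convex medial_tri"
    unfolding convex_def medial_tri_def
  proof (clarsimp)
    fix a b c d u v :: real
    assume h: "a \<le> 4" "b \<le> 4" "4 \<le> a + b" "c \<le> 4" "d \<le> 4" "4 \<le> c + d" "0 \<le> u" "0 \<le> v" "u + v = 1"
    have four: "u * 4 + v * 4 = 4" using h(9) by linarith
    have "u * a \<le> u * 4" "v * c \<le> v * 4" "u * b \<le> u * 4" "v * d \<le> v * 4"
      "u * 4 \<le> u * (a + b)" "v * 4 \<le> v * (c + d)"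
      using h by (intro mult_left_mono; simp)+
    then show "u * a + v * c \<le> 4 \<and> u * b + v * d \<le> 4 \<and> 4 \<le> u * a + v * c + (u * b + v * d)"
      using four unfolding distrib_left by (intro conjI) linarith+
  qed
  then show ?thesis
    unfolding link_pt_def linepath_def using assms spot_medial by (intro convexD) auto
qed

lemma link_open:
  assumes "l \<in> all_links" "0 < t" "t < 1"
  shows "link_pt l t \<in> open_tri"
  using assms(1)
  by (elim UnE insertE emptyE; hypsubst)
    (use assms(2,3) in \<open>simp_all add: link_pt_def linepath_def open_tri_def\<close>)

lemma link_inj:
  assumes "l \<in> all_links" "link_pt l t = link_pt l t'"
  shows "t = t'"
  using assms(1)
  by (elim UnE insertE emptyE; hypsubst)
    (use assms(2) in \<open>simp_all add: link_pt_def linepath_def\<close>)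

text \<open>
  For each of the pairs of segments this is a question about two linear equations in two bounded unknowns.
\<close>

lemma link_cross:
  assumes "l \<in> all_links" "l' \<in> all_links" "l \<noteq> l'" "0 < t" "t < 1" "0 \<le> t'" "t' \<le> 1"
  shows "link_pt l t \<noteq> link_pt l' t'"
proof
  assume eq: "link_pt l t = link_pt l' t'"
  show False
    using assms(1,2)
    by (elim UnE insertE emptyE; hypsubst)
      (use assms(3-) eq in \<open>simp_all add: link_pt_def linepath_def\<close>)
qed

lemma chart_inj: "chart c z = chart c z' \<Longrightarrow> z = z'"
  by (cases c; cases z; cases z') auto

text \<open>
  An interior point of a cell determines the integer parts of its coordinates, and the side of the
  diagonal on which it lies.
\<close>

lemma chart_separate:
  assumes "chart c z = chart c' z'" "cell_sheet c = cell_sheet c'" "z \<in> open_tri" "z' \<in> closed_tri"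
  shows "c = c'"
proof -
  obtain x y x' y' where z: "z = (x, y)" "z' = (x', y')" by force
  have i: "i = k" if "real_of_int i < real_of_int k + 1" "real_of_int k < real_of_int i + 1" for i k :: int
    using that by linarith
  show ?thesis
  proof (cases c; cases c')
    fix s i j t k l
    assume c: "c = Up s i j" "c' = Up t k l"
    have "i = k" "j = l" using assms unfolding c z by (intro i; auto simp: open_tri_def closed_tri_def)+
    then show ?thesis using assms(2) unfolding c by simp
  next
    fix s i j t k l
    assume c: "c = Up s i j" "c' = Dn t k l"
    have "i = k" "j = l" using assms unfolding c z by (intro i; auto simp: open_tri_def closed_tri_def)+
    then show ?thesis using assms unfolding c z by (auto simp: open_tri_def closed_tri_def)
  next
    fix s i j t k l
    assume c: "c = Dn s i j" "c' = Up t k l"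
    have "i = k" "j = l" using assms unfolding c z by (intro i; auto simp: open_tri_def closed_tri_def)+
    then show ?thesis using assms unfolding c z by (auto simp: open_tri_def closed_tri_def)
  next
    fix s i j t k l
    assume c: "c = Dn s i j" "c' = Dn t k l"
    have "i = k" "j = l" using assms unfolding c z by (intro i; auto simp: open_tri_def closed_tri_def)+
    then show ?thesis using assms(2) unfolding c by simp
  qed
qed

text \<open>
  The origin is a corner of the cells around it.
\<close>

lemma chart_medial_nonzero:
  assumes "z \<in> medial_tri"
  shows "chart c z \<noteq> 0"
proof
  assume 0: "chart c z = 0"
  obtain x y where z: "z = (x, y)" by force
  have up: "x = 0" if "8 * real_of_int i + x = 0" "0 \<le> x" "x \<le> 4" for i x
  proof -
    have "- 1 < real_of_int i" "real_of_int i < 1" using that by linarith+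
    then have "i = 0" by linarith
    then have "8 * real_of_int i = 0" by simp
    then show ?thesis using that(1) by linarith
  qed
  have xy: "0 \<le> x" "x \<le> 4" "0 \<le> y" "y \<le> 4" "4 \<le> x + y" using assms unfolding z medial_tri_def by auto
  show False
  proof (cases c)
    case (Up s i j)
    then show ?thesis using 0 xy up[of i x] up[of j y] unfolding z by (simp add: zero_prod_def)
  next
    case (Dn s i j)
    then show ?thesis using 0 xy up[of "- i - 1" x] up[of "- j - 1" y] unfolding z by (simp add: zero_prod_def)
  qed
qed

text \<open>
  The gauge function of the triangle bounded by \<open>x = - 1\<close>, \<open>y = - 1\<close> and \<open>x + y = 1\<close>: it is positively
  homogeneous, and the large triangle is the set where it is at most \<open>8 m\<close>.
\<close>

definition gauge :: "real \<times> real \<Rightarrow> real" where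
  "gauge z = max (max (- fst z) (- snd z)) (fst z + snd z)"

lemma gauge_pos: "z \<noteq> 0 \<Longrightarrow> 0 < gauge z"
  by (cases z) (auto simp: gauge_def max_def zero_prod_def)

lemma gauge_scale: "0 \<le> a \<Longrightarrow> gauge (a *\<^sub>R z) = a * gauge z"
  by (cases z) (simp add: gauge_def max_mult_distrib_left distrib_left)

context folded_triangle
begin

text \<open>
  On each ray from the origin this is the inversion that fixes the boundary point of the large triangle.
\<close>

definition flip :: "real \<times> real \<Rightarrow> real \<times> real" where
  "flip z = (8 * of_int m / gauge z)\<^sup>2 *\<^sub>R z"

definition sheet :: "bool \<Rightarrow> real \<times> real \<Rightarrow> real \<times> real" where
  "sheet s = (if s then flip else (\<lambda>z. z))"

lemma gauge_flip: "z \<noteq> 0 \<Longrightarrow> gauge (flip z) = (8 * of_int m)\<^sup>2 / gauge z"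
  using gauge_pos[of z] by (simp add: flip_def gauge_scale power2_eq_square)

lemma flip_flip:
  assumes "z \<noteq> 0"
  shows "flip (flip z) = z"
proof -
  have g: "0 < gauge z" "0 < real_of_int m" using gauge_pos[OF assms] m_pos by auto
  have "flip (flip z) = (8 * of_int m / gauge (flip z))\<^sup>2 *\<^sub>R ((8 * of_int m / gauge z)\<^sup>2 *\<^sub>R z)"
    by (simp add: flip_def)
  also have "\<dots> = ((8 * of_int m / gauge (flip z)) * (8 * of_int m / gauge z))\<^sup>2 *\<^sub>R z"
    by (simp only: scaleR_scaleR power_mult_distrib)
  also have "(8 * of_int m / gauge (flip z)) * (8 * of_int m / gauge z) = 1"
    unfolding gauge_flip[OF assms] using g by (simp add: field_simps power2_eq_square)
  finally show ?thesis by simp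
qed

lemma flip_inj: "z \<noteq> 0 \<Longrightarrow> w \<noteq> 0 \<Longrightarrow> flip z = flip w \<Longrightarrow> z = w"
  using flip_flip by metis

lemma flip_rim: "gauge z = 8 * of_int m \<Longrightarrow> flip z = z"
  using m_pos by (simp add: flip_def)

lemma gauge_chart_closed:
  assumes "cell_ok c" "z \<in> closed_tri"
  shows "gauge (chart c z) \<le> 8 * of_int m"
proof -
  obtain x y where z: "z = (x, y)" by force
  show ?thesis
  proof (cases c)
    case (Up s i j)
    have "- real_of_int m \<le> real_of_int i" "- real_of_int m \<le> real_of_int j"
      "real_of_int i + real_of_int j + 1 \<le> real_of_int m"
      using assms(1) unfolding Up by simp_all
    then show ?thesis using assms(2) unfolding Up z by (simp add: gauge_def closed_tri_def)
  next
    case (Dn s i j)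
    have "- real_of_int m \<le> real_of_int i" "- real_of_int m \<le> real_of_int j"
      "real_of_int i + real_of_int j + 2 \<le> real_of_int m"
      using assms(1) unfolding Dn by simp_all
    then show ?thesis using assms(2) unfolding Dn z by (simp add: gauge_def closed_tri_def)
  qed
qed

lemma gauge_chart_open:
  assumes "cell_ok c" "z \<in> open_tri"
  shows "gauge (chart c z) < 8 * of_int m"
proof -
  obtain x y where z: "z = (x, y)" by force
  show ?thesis
  proof (cases c)
    case (Up s i j)
    have "- real_of_int m \<le> real_of_int i" "- real_of_int m \<le> real_of_int j"
      "real_of_int i + real_of_int j + 1 \<le> real_of_int m"
      using assms(1) unfolding Up by simp_all
    then show ?thesis using assms(2) unfolding Up z by (simp add: gauge_def open_tri_def)
  next
    case (Dn s i j)
    have "- real_of_int m \<le> real_of_int i" "- real_of_int m \<le> real_of_int j"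
      "real_of_int i + real_of_int j + 2 \<le> real_of_int m"
      using assms(1) unfolding Dn by simp_all
    then show ?thesis using assms(2) unfolding Dn z by (simp add: gauge_def open_tri_def)
  qed
qed

lemma gauge_flip_closed:
  assumes "z \<noteq> 0" "gauge z \<le> 8 * of_int m"
  shows "8 * of_int m \<le> gauge (flip z)"
  unfolding gauge_flip[OF assms(1)] using gauge_pos[OF assms(1)] assms(2) m_pos
  by (simp add: pos_le_divide_eq power2_eq_square)

lemma gauge_flip_open:
  assumes "z \<noteq> 0" "gauge z < 8 * of_int m"
  shows "8 * of_int m < gauge (flip z)"
  unfolding gauge_flip[OF assms(1)] using gauge_pos[OF assms(1)] assms(2) m_pos
  by (simp add: pos_less_divide_eq power2_eq_square)

text \<open>
  Front points have gauge at most \<open>8 m\<close>, flipped points at least \<open>8 m\<close>, and on the interior of the large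
  triangle both bounds are strict; so points of different sheets can only meet on the boundary.
\<close>

lemma chart_separate_sheets:
  assumes ok: "cell_ok c" "cell_ok c'" and z: "z \<in> medial_tri \<inter> open_tri" "z' \<in> medial_tri"
    and eq: "sheet (cell_sheet c) (chart c z) = sheet (cell_sheet c') (chart c' z')"
  shows "c = c' \<and> z = z'"
proof -
  note nz = chart_medial_nonzero[of z c] chart_medial_nonzero[OF z(2), of c']
  have g: "gauge (chart c z) < 8 * of_int m" using gauge_chart_open ok z by blast
  have g': "gauge (chart c' z') \<le> 8 * of_int m" using gauge_chart_closed ok z medial_closed by blast
  have "cell_sheet c = cell_sheet c' \<and> chart c z = chart c' z'"
  proof (cases "cell_sheet c"; cases "cell_sheet c'")
    assume s: "cell_sheet c" "cell_sheet c'"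
    then show ?thesis using eq flip_inj nz z unfolding sheet_def by auto
  next
    assume s: "cell_sheet c" "\<not> cell_sheet c'"
    then have "flip (chart c z) = chart c' z'" using eq unfolding sheet_def by simp
    then show ?thesis using gauge_flip_open[OF _ g] g' nz z by auto
  next
    assume s: "\<not> cell_sheet c" "cell_sheet c'"
    then have "chart c z = flip (chart c' z')" using eq unfolding sheet_def by simp
    then show ?thesis using gauge_flip_closed[OF _ g'] g nz z by auto
  next
    assume s: "\<not> cell_sheet c" "\<not> cell_sheet c'"
    then show ?thesis using eq unfolding sheet_def by simp
  qed
  then have c: "c = c'" using chart_separate[of c z c' z'] z medial_closed by blast
  then show ?thesis using chart_inj \<open>_ \<and> chart c z = chart c' z'\<close> by blast
qed

end

section \<open>The plane drawing\<close>

context folded_triangle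
begin

definition place :: "vertex \<Rightarrow> real \<times> real" where
  "place v = sheet (vertex_sheet v) (pos v)"

definition curve :: "cell \<times> (spot \<times> spot) \<Rightarrow> real \<Rightarrow> real \<times> real" where
  "curve q t = sheet (cell_sheet (fst q)) (chart (fst q) (link_pt (snd q) t))"

lemma links_all: "links c \<subseteq> all_links"
  by (cases c) (simp_all, blast?)

lemma pos_rim:
  assumes "- m \<le> i" "- m \<le> j" "i + j < m" "rim d i j"
  shows "gauge (chart (Up s i j) (spot_pos (Side d))) = 8 * of_int m"
proof -
  have "- real_of_int m \<le> real_of_int i" "- real_of_int m \<le> real_of_int j"
    "real_of_int i + real_of_int j + 1 \<le> real_of_int m"
    using assms by simp_all
  moreover have "real_of_int i + real_of_int j + 1 = real_of_int m" if "d = Dia"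
    using assms(4) that by simp
  ultimately show ?thesis
    using assms(4) m_pos by (cases d) (auto simp: gauge_def max_def)
qed

lemma pos_not_rim:
  assumes "- m \<le> i" "- m \<le> j" "i + j < m" "\<not> rim d i j"
  shows "gauge (chart (Up s i j) (spot_pos (Side d))) < 8 * of_int m"
proof -
  have "- real_of_int m \<le> real_of_int i" "- real_of_int m \<le> real_of_int j"
    "real_of_int i + real_of_int j + 1 \<le> real_of_int m"
    using assms by simp_all
  moreover have "- real_of_int m < real_of_int j" if "d = Hor"
    using assms(2,4) that by simp
  moreover have "- real_of_int m < real_of_int i" if "d = Ver"
    using assms(1,4) that by simp
  moreover have "real_of_int i + real_of_int j + 1 < real_of_int m" if "d = Dia"
    using assms(3,4) that by simp
  ultimately show ?thesis
    using m_pos by (cases d) (auto simp: gauge_def)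
qed

lemma chart_True: "chart (Up True i j) z = chart (Up False i j) z"
  by (cases z) simp

text \<open>
  A boundary midpoint of a back cell is stored as a vertex of the front sheet. The two positions agree
  because \<open>flip\<close> fixes the boundary.
\<close>

lemma place_vertex_at:
  assumes "cell_ok c"
  shows "place (vertex_at c u) = sheet (cell_sheet c) (chart c (spot_pos u))"
proof (cases c)
  case (Up s i j)
  show ?thesis
  proof (cases u)
    case (Side d)
    show ?thesis
      using flip_rim[OF pos_rim[of i j d]] assms unfolding Up Side
      by (auto simp: place_def sheet_def chart_True)
  next
    case (Core t)
    then show ?thesis unfolding Up by (simp add: place_def)
  qed
next
  case (Dn s i j)
  show ?thesis unfolding Dn
    by (cases u rule: spot_pos.cases) (simp_all add: place_def algebra_simps)
qed

lemma curve_ends: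
  assumes "q \<in> edge_index"
  shows "curve q 0 = place (vertex_at (fst q) (fst (snd q)))" "curve q 1 = place (vertex_at (fst q) (snd (snd q)))"
  using assms place_vertex_at[of "fst q"] by (auto simp: curve_def link_pt_def linepath_def edge_index_def)

lemma curve_cross:
  assumes q: "q \<in> edge_index" "q' \<in> edge_index" and t: "0 < t" "t < 1" "0 \<le> t'" "t' \<le> 1"
    and eq: "curve q t = curve q' t'"
  shows "q = q' \<and> t = t'"
proof -
  obtain c l where ql1: "q = (c, l)" by (rule prod.exhaust)
  obtain c' l' where ql2: "q' = (c', l')" by (rule prod.exhaust)
  note ql = ql1 ql2
  have "cell_ok c" "cell_ok c'" "l \<in> links c" "l' \<in> links c'"
    using q unfolding ql edge_index_def by simp_all
  then have ok: "cell_ok c" "cell_ok c'" "l \<in> all_links" "l' \<in> all_links"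
    using links_all by blast+
  have "c = c' \<and> link_pt l t = link_pt l' t'"
    using chart_separate_sheets[OF ok(1,2), of "link_pt l t" "link_pt l' t'"]
      link_open[OF ok(3) t(1,2)] link_medial[of t l] link_medial[of t' l'] t eq
    unfolding curve_def ql by simp
  then show ?thesis
    using link_cross[OF ok(3,4) _ t] link_inj[OF ok(3)] unfolding ql by blast
qed

text \<open>
  An inner vertex lies in an open cell, which separates it from all other vertices. Two midpoints of
  different directions on the same sheet differ because their coordinates differ modulo 8, and a back
  midpoint, not being on the boundary, is flipped to the outside of the large triangle.
\<close>

lemma place_inj: "inj_on place verts"
proof (rule inj_onI)
  fix u v assume uv: "u \<in> verts" "v \<in> verts" and eq: "place u = place v"
  have ok: "vertex_ok u" "vertex_ok v" using uv unfolding verts_def by auto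
  have inn: "Inn t c = w" if w: "vertex_ok (Inn t c)" "vertex_ok w" "place (Inn t c) = place w" for t c w
  proof -
    have c: "cell_ok c" using w(1) by (cases c) simp_all
    have "\<exists>c' a. cell_ok c' \<and> w = vertex_at c' a"
    proof (cases w)
      case (Mid d s i j)
      then have "cell_ok (Up s i j) \<and> w = vertex_at (Up s i j) (Side d)" using w(2) by auto
      then show ?thesis by blast
    next
      case (Inn t' c')
      then have "cell_ok c' \<and> w = vertex_at c' (Core t')" using w(2) by (cases c') auto
      then show ?thesis by blast
    qed
    then obtain c' a where c': "cell_ok c'" "w = vertex_at c' a" by blast
    have op: "spot_pos (Core t) \<in> open_tri" by (cases t) (simp_all add: open_tri_def)
    have l: "Inn t c = vertex_at c (Core t)" by (cases c) simp_all
    have e: "sheet (cell_sheet c) (chart c (spot_pos (Core t))) = sheet (cell_sheet c') (chart c' (spot_pos a))"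
      using w(3) unfolding l c'(2) place_vertex_at[OF c] place_vertex_at[OF c'(1)] .
    have "c = c' \<and> spot_pos (Core t) = spot_pos a"
      by (rule chart_separate_sheets[OF c c'(1) IntI[OF spot_medial op] spot_medial e])
    then have "c = c'" "a = Core t" by (cases t; cases a rule: spot_pos.cases; simp)+
    then show ?thesis unfolding l c'(2) by simp
  qed
  show "u = v"
  proof (cases u)
    case u: (Mid d s i j)
    show ?thesis
    proof (cases v)
      case v: (Mid e t k l)
      let ?p = "chart (Up s i j) (spot_pos (Side d))" and ?q = "chart (Up t k l) (spot_pos (Side e))"
      have nz: "?p \<noteq> 0" "?q \<noteq> 0" using chart_medial_nonzero spot_medial by blast+
      have gp: "gauge ?p \<le> 8 * of_int m" "gauge ?q \<le> 8 * of_int m"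
        by (rule gauge_chart_closed; use ok spot_medial medial_closed in \<open>auto simp: u v simp del: spot_pos.simps\<close>)+
      have gs: "gauge ?p < 8 * of_int m" if s using ok(1) that unfolding u by (intro pos_not_rim) simp_all
      have gt: "gauge ?q < 8 * of_int m" if t using ok(2) that unfolding v by (intro pos_not_rim) simp_all
      have eq': "sheet s ?p = sheet t ?q" using eq unfolding u v place_def by simp
      have "s = t"
      proof (cases s; cases t)
        assume st: "s" "\<not> t"
        then have "flip ?p = ?q" using eq' unfolding sheet_def by (simp del: chart.simps)
        then show ?thesis using gauge_flip_open[OF nz(1) gs[OF st(1)]] gp(2) by (simp del: chart.simps)
      next
        assume st: "\<not> s" "t"
        then have "?p = flip ?q" using eq' unfolding sheet_def by (simp del: chart.simps)
        then show ?thesis using gauge_flip_open[OF nz(2) gt[OF st(2)]] gp(1) by (simp del: chart.simps)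
      qed simp_all
      then have "sheet s ?p = sheet s ?q" using eq' by (simp only:)
      then have "?p = ?q" using flip_inj[OF nz] unfolding sheet_def by (cases s) (simp_all only: if_True if_False)
      moreover have no: "8 * real_of_int a + 4 \<noteq> 8 * real_of_int b" for a b
      proof
        assume "8 * real_of_int a + 4 = 8 * real_of_int b"
        then have "real_of_int (8 * a + 4) = real_of_int (8 * b)" by simp
        then have "8 * a + 4 = 8 * b" by (simp only: of_int_eq_iff)
        then show False by presburger
      qed
      ultimately show ?thesis
        using \<open>s = t\<close> no[symmetric] unfolding u v by (cases d; cases e) simp_all
    next
      case v: (Inn t c)
      then show ?thesis using inn[of t c u] ok eq by simp
    qed
  next
    case u: (Inn t c)
    then show ?thesis using inn[of t c v] ok eq by simp
  qed
qed

lemma continuous_sheet: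
  assumes "0 \<notin> S"
  shows "continuous_on S (sheet s)"
proof -
  have "continuous_on S gauge" unfolding gauge_def by (intro continuous_intros)
  moreover have "gauge z \<noteq> 0" if "z \<in> S" for z
  proof -
    have "z \<noteq> 0" using that assms by blast
    then show ?thesis using gauge_pos[of z] by simp
  qed
  ultimately have "continuous_on S flip" unfolding flip_def by (intro continuous_intros) auto
  then show ?thesis by (simp add: sheet_def)
qed

lemma continuous_chart: "continuous_on S (chart c)"
proof -
  have "chart (Up s i j) = (\<lambda>z. (8 * of_int i + fst z, 8 * of_int j + snd z))"
    "chart (Dn s i j) = (\<lambda>z. (8 * of_int i + 8 - fst z, 8 * of_int j + 8 - snd z))" for s i j
    by auto
  then show ?thesis by (cases c) (auto intro!: continuous_intros)
qed

lemma arc_curve: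
  assumes q: "q \<in> edge_index"
  shows "arc (curve q)"
proof -
  obtain c l where ql: "q = (c, l)" by (rule prod.exhaust)
  have ok: "cell_ok c" "l \<in> links c" using q unfolding ql edge_index_def by simp_all
  have "continuous_on {0..1} (\<lambda>t. sheet (cell_sheet c) (chart c (link_pt l t)))"
  proof (rule continuous_on_compose2[OF continuous_sheet])
    show "continuous_on {0..1} (\<lambda>t. chart c (link_pt l t))"
      by (rule continuous_on_compose2[OF continuous_chart[of UNIV]])
        (auto simp: link_pt_def)
    show "0 \<notin> (\<lambda>t. chart c (link_pt l t)) ` {0..1}"
      using chart_medial_nonzero link_medial by fastforce
  qed simp
  moreover have "inj_on (curve q) {0..1}"
  proof (rule inj_onI)
    fix t t' :: real assume t: "t \<in> {0..1}" "t' \<in> {0..1}" and eq: "curve q t = curve q t'"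
    show "t = t'"
    proof (cases "(0 < t \<and> t < 1) \<or> (0 < t' \<and> t' < 1)")
      case True
      then show ?thesis using curve_cross[OF q q, of t t'] curve_cross[OF q q, of t' t] t eq by auto
    next
      case False
      then have "t = 0 \<or> t = 1" "t' = 0 \<or> t' = 1" using t by auto
      moreover have "curve q 0 \<noteq> curve q 1"
      proof -
        have "vertex_at c (fst l) \<noteq> vertex_at c (snd l)"
          using vertex_at_inj links_asym[of "fst l" "snd l" c] q unfolding ql edge_index_def by auto
        moreover have "vertex_at c (fst l) \<in> verts" "vertex_at c (snd l) \<in> verts"
          using edge_subset[of c l] q unfolding ql edge_index_def edge_def by auto
        ultimately show ?thesis
          using place_inj unfolding curve_ends[OF q] unfolding inj_on_def ql by auto
      qed
      ultimately show ?thesis using eq by auto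
    qed
  qed
  ultimately show ?thesis unfolding arc_def path_def by (simp add: curve_def ql)
qed

lemma verts_covered:
  assumes "v \<in> verts"
  shows "\<exists>e\<in>edges. v \<in> e"
proof -
  have *: ?thesis if "cell_ok c" "l \<in> links c" "v = vertex_at c (fst l) \<or> v = vertex_at c (snd l)" for c l
    using that unfolding edges_def edge_index_def edge_def by force
  have ok: "vertex_ok v" using assms unfolding verts_def by simp
  show ?thesis
  proof (cases v)
    case (Mid d s i j)
    have c: "cell_ok (Up s i j)" and v: "v = vertex_at (Up s i j) (Side d)" using ok unfolding Mid by auto
    have "\<exists>l \<in> links (Up s i j). Side d \<in> {fst l, snd l}"
    proof (cases "s \<and> corner i j")
      case True
      have "\<not> rim d i j" using ok True unfolding Mid by simp
      then show ?thesis using True by (cases d) (auto simp: corner_def)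
    next
      case False
      then have "outer_links \<subseteq> links (Up s i j)" by auto
      then show ?thesis by (cases d) auto
    qed
    then show ?thesis using *[OF c] v by auto
  next
    case (Inn t c)
    have c: "cell_ok c" using ok unfolding Inn by (cases c) simp_all
    have l: "(Core t, if t then Core False else Side Hor) \<in> links c"
      using ok unfolding Inn by (cases c; cases t) auto
    have "v = vertex_at c (Core t)" using Inn by (cases c) simp_all
    then show ?thesis using *[OF c l] by simp
  qed
qed

text \<open>
  That no vertex lies in the interior of an edge follows from the disjointness of edges, as every
  vertex is an end of some edge.
\<close>

lemma planar_edges: "planar verts edges"
proof -
  define index_of where "index_of e = (SOME q. q \<in> edge_index \<and> edge (fst q) (snd q) = e)" for e
  have index_of: "index_of e \<in> edge_index \<and> edge (fst (index_of e)) (snd (index_of e)) = e" if "e \<in> edges" for e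
  proof -
    have "\<exists>q. q \<in> edge_index \<and> edge (fst q) (snd q) = e"
      using that unfolding edges_def by force
    then show ?thesis unfolding index_of_def by (rule someI_ex)
  qed
  let ?g = "\<lambda>e. curve (index_of e)"
  have ends: "place ` e = {curve (index_of e) 0, curve (index_of e) 1}" if "e \<in> edges" for e
    using index_of[OF that] curve_ends[of "index_of e"] unfolding edge_def by (metis image_empty image_insert)
  have cross: "(path_image (?g e) - place ` e) \<inter> path_image (?g f) = {}"
    if e: "e \<in> edges" and f: "f \<in> edges" and ne: "e \<noteq> f" for e f
  proof (rule ccontr)
    assume "\<not> ?thesis"
    then obtain z where z: "z \<in> path_image (?g e)" "z \<notin> place ` e" "z \<in> path_image (?g f)" by blast
    obtain t where t: "0 \<le> t" "t \<le> 1" "z = ?g e t" using z(1) unfolding path_image_def by auto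
    obtain t' where t': "0 \<le> t'" "t' \<le> 1" "z = ?g f t'" using z(3) unfolding path_image_def by auto
    have "t \<noteq> 0" "t \<noteq> 1" using z(2) unfolding ends[OF e] t(3) by auto
    then have "0 < t" "t < 1" using t by simp_all
    moreover have "index_of e \<in> edge_index" "index_of f \<in> edge_index" using index_of e f by blast+
    ultimately have "index_of e = index_of f" using curve_cross[of "index_of e" "index_of f" t t'] t t' by metis
    then show False using index_of[OF e] index_of[OF f] ne by metis
  qed
  have away: "(path_image (?g e) - place ` e) \<inter> place ` verts = {}" if e: "e \<in> edges" for e
  proof (rule ccontr)
    assume "\<not> ?thesis"
    then obtain v where v: "v \<in> verts" "place v \<in> path_image (?g e)" "place v \<notin> place ` e" by blast
    obtain f where f: "f \<in> edges" "v \<in> f" using verts_covered[OF v(1)] by blast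
    have "place v \<in> {?g f 0, ?g f 1}" unfolding ends[OF f(1), symmetric] using f(2) by (rule imageI)
    then have "place v \<in> path_image (?g f)" unfolding path_image_def by auto
    moreover have "e \<noteq> f" using v(3) f(2) by blast
    ultimately show False using cross[OF e f(1)] v by blast
  qed
  have "arc (?g e)" "{pathstart (?g e), pathfinish (?g e)} = place ` e" if "e \<in> edges" for e
    using arc_curve index_of[OF that] ends[OF that] unfolding pathstart_def pathfinish_def by simp_all
  then have "plane_drawing verts edges place ?g"
    unfolding plane_drawing_def
    using place_inj cross away by blast
  then show ?thesis unfolding planar_def by blast
qed

end

lemma planar_image:
  fixes f :: "'a \<Rightarrow> 'b"
  assumes f: "inj f" and planar: "planar V E"
  shows "planar (f ` V) ((`) f ` E)"
proof -
  obtain p g where pg: "plane_drawing V E p g" using planar unfolding planar_def by blast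
  have inv: "inv f ` f ` e = e" for e using f by (simp add: image_image)
  have vert: "(p \<circ> inv f) ` f ` e = p ` e" for e using f by (simp add: image_image)
  have p: "inj_on p V"
    and 3: "\<forall>e\<in>E. arc (g e) \<and> {pathstart (g e), pathfinish (g e)} = p ` e"
    and 4: "\<forall>e\<in>E. (path_image (g e) - p ` e) \<inter> p ` V = {}"
    and 5: "\<forall>e\<in>E. \<forall>h\<in>E. e \<noteq> h \<longrightarrow> (path_image (g e) - p ` e) \<inter> path_image (g h) = {}"
    using pg unfolding plane_drawing_def by - (elim conjE, assumption)+
  have 1: "inj_on (p \<circ> inv f) (f ` V)"
    using p f by (auto simp: inj_on_def)
  have 2: "\<forall>e\<in>E. \<forall>h\<in>E. f ` e \<noteq> f ` h \<longrightarrow> (path_image (g e) - p ` e) \<inter> path_image (g h) = {}"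
  proof (intro ballI impI)
    fix e h assume eh: "e \<in> E" "h \<in> E" and ne: "f ` e \<noteq> f ` h"
    have "e \<noteq> h" using ne by blast
    with 5 eh show "(path_image (g e) - p ` e) \<inter> path_image (g h) = {}" by simp
  qed
  have "plane_drawing (f ` V) ((`) f ` E) (p \<circ> inv f) (\<lambda>e. g (inv f ` e))"
    unfolding plane_drawing_def ball_simps inv vert using 1 2 3 4 by (intro conjI)
  then show ?thesis unfolding planar_def by blast
qed

section \<open>The extremal graphs\<close>

lemma theta6_free_image:
  fixes f :: "'a \<Rightarrow> 'b"
  assumes f: "inj f" and no: "\<And>a b c d e h. distinct [a, b, c, d, e, h] \<Longrightarrow>
      {{a,b},{b,c},{c,d},{d,e},{e,h},{h,a}} \<subseteq> E \<Longrightarrow> {a,c} \<notin> E \<and> {a,d} \<notin> E"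
  shows "theta_free 6 (f ` V) ((`) f ` E)"
proof (rule theta6_freeI)
  have mem: "{f x, f y} \<in> (`) f ` E \<longleftrightarrow> {x, y} \<in> E" for x y
  proof -
    have "{f x, f y} = f ` {x, y}" by simp
    then show ?thesis using inj_image_mem_iff[of "(`) f" "{x, y}" E] f by (simp add: inj_image_eq_iff inj_def)
  qed
  have rng: "u \<in> range f" if "{u, w} \<in> (`) f ` E" for u w
  proof -
    obtain e where "{u, w} = f ` e" using \<open>{u, w} \<in> (`) f ` E\<close> by blast
    then show ?thesis by blast
  qed
  fix a b c d e h :: 'b
  assume D: "distinct [a, b, c, d, e, h]"
    and E: "{{a,b},{b,c},{c,d},{d,e},{e,h},{h,a}} \<subseteq> (`) f ` E"
  have "a \<in> range f" "b \<in> range f" "c \<in> range f" "d \<in> range f" "e \<in> range f" "h \<in> range f"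
    using E rng by (meson insert_subset)+
  then obtain a' b' c' d' e' h' where v: "a = f a'" "b = f b'" "c = f c'" "d = f d'" "e = f e'" "h = f h'"
    by blast
  have "{{a',b'},{b',c'},{c',d'},{d',e'},{e',h'},{h',a'}} \<subseteq> E"
    using E unfolding v by (simp only: insert_subset mem empty_subsetI simp_thms)
  moreover have "distinct [a', b', c', d', e', h']" using D unfolding v by auto
  ultimately have "{a', c'} \<notin> E \<and> {a', d'} \<notin> E" by (rule no[rotated])
  then show "{a, c} \<notin> (`) f ` E \<and> {a, d} \<notin> (`) f ` E" unfolding v by (simp only: mem simp_thms)
qed

context folded_triangle
begin

lemma simple_edges: "simple_graph verts edges"
proof -
  have "card e = 2" if "e \<in> edges" for e
  proof -
    obtain c l where c: "cell_ok c" "l \<in> links c" "e = edge c l"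
      using \<open>e \<in> edges\<close> unfolding edges_def edge_index_def by auto
    have "vertex_at c (fst l) \<noteq> vertex_at c (snd l)"
      using vertex_at_inj links_asym[of "fst l" "snd l" c] c(2) by auto
    then show ?thesis unfolding c(3) edge_def by simp
  qed
  then show ?thesis unfolding simple_graph_def using card_verts(1) edges_subset by blast
qed

lemma extremal_graph:
  "\<exists>(V :: nat set) (E :: nat set set). simple_graph V E \<and> int (card V) = 63 * m\<^sup>2 - 9 \<and>
     planar V E \<and> theta_free 6 V E \<and> real (card E) = 18 / 7 * real (card V) - 48 / 7"
proof -
  interpret bipartite_labelling verts edges black_label white_label by (rule labelling)
  let ?V = "to_nat ` verts" and ?E = "(`) to_nat ` edges"
  have inj: "inj (to_nat :: vertex \<Rightarrow> nat)" by simp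
  have inj': "inj ((`) (to_nat :: vertex \<Rightarrow> nat))" by (simp add: inj_def inj_image_eq_iff)
  have V: "card ?V = card verts" by (rule card_image) (rule inj_on_subset[OF inj subset_UNIV])
  have E: "card ?E = card edges" by (rule card_image) (rule inj_on_subset[OF inj' subset_UNIV])
  have "7 * int (card edges) = 18 * int (card verts) - 48"
    using card_verts(2) card_edges by simp
  then have "7 * real (card edges) = 18 * real (card verts) - 48" by linarith
  then have "real (card ?E) = 18 / 7 * real (card ?V) - 48 / 7" unfolding V E by simp
  moreover have "simple_graph ?V ?E"
    using simple_edges inj unfolding simple_graph_def by (auto simp: card_image inj_on_subset[OF inj subset_UNIV])
  moreover have "planar ?V ?E" by (rule planar_image[OF inj planar_edges])
  moreover have "theta_free 6 ?V ?E" by (rule theta6_free_image[OF inj no_chord])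
  ultimately show ?thesis using V card_verts(2) by metis
qed

end

theorem theorem5:
  "infinite {n::nat. n > 0 \<and>
     (\<exists>(V :: nat set) (E :: nat set set).
        simple_graph V E \<and> card V = n \<and> planar V E \<and> theta_free 6 V E \<and>
        real (card E) = 18 / 7 * real n - 48 / 7)}"
  (is "infinite ?S")
proof -
  have mem: "nat (63 * (1 + int k)\<^sup>2 - 9) \<in> ?S" for k
  proof -
    interpret folded_triangle "1 + int k" by unfold_locales simp
    obtain V :: "nat set" and E :: "nat set set" where G: "simple_graph V E" "int (card V) = 63 * (1 + int k)\<^sup>2 - 9"
      "planar V E" "theta_free 6 V E" "real (card E) = 18 / 7 * real (card V) - 48 / 7"
      using extremal_graph by blast
    have n: "nat (63 * (1 + int k)\<^sup>2 - 9) = card V" using G(2) by simp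
    have "1 \<le> (1 + int k)\<^sup>2" by (simp add: one_le_power)
    then have "0 < card V" using G(2) by linarith
    then show ?thesis unfolding n using G by blast
  qed
  have "inj (\<lambda>k. nat (63 * (1 + int k)\<^sup>2 - 9))"
  proof (rule injI)
    fix k l assume eq: "nat (63 * (1 + int k)\<^sup>2 - 9) = nat (63 * (1 + int l)\<^sup>2 - 9)"
    have "1 \<le> (1 + int k)\<^sup>2" "1 \<le> (1 + int l)\<^sup>2" by (simp_all add: one_le_power)
    then have "(1 + int k)\<^sup>2 = (1 + int l)\<^sup>2" using eq by linarith
    then show "k = l" by (simp add: power2_eq_iff_nonneg)
  qed
  then have "infinite (range (\<lambda>k. nat (63 * (1 + int k)\<^sup>2 - 9)))" by (rule range_inj_infinite)
  moreover have "range (\<lambda>k. nat (63 * (1 + int k)\<^sup>2 - 9)) \<subseteq> ?S"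
    by (rule image_subsetI) (rule mem)
  ultimately show ?thesis by (rule infinite_super[rotated])
qed

end
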